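(* Let $\mathbb{F}_q$ be any finite field, and let $M=(E,I)$ be any non-free, $\mathbb{F}_q$-representable matroid with rank $r(M)$ and exactly $\ell$ loops. If $m:\mathbb{N}\to\mathbb{N}$ satisfies $n>m(n)\geq|E|$ for all sufficiently large $n$, then $$ \liminf_{n\to\infty}\mathbb{P}_{A_n\sim[U_q]^{m(n)\times n}}\{M \text{ is a minor of } M[A_n]\} > \left(1-q^{-|E|}\right)p_{|E|-1,q,M}, $$ where $$ p_{s,q,M}=\binom{|E|}{\ell}\left(\frac{(q-1)^{|E|-r(M)-\ell}}{q^{s(|E|-r(M))}}\right)\prod_{i=0}^{r(M)-1}\left(1-q^{i-s}\right). $$
   Context: $\mathbb{F}_q$ is the finite field with $q$ elements. $[U_q]^{m\times n}$ denotes the uniform distribution on $\mathbb{F}_q^{m\times n}$ (entries i.i.d. uniform on $\mathbb{F}_q$), and $A \sim [U_q]^{m \times n}$ means that $A$ is drawn from it. For a matrix $A$ over $\mathbb{F}_q$ with $n$ columns, $M[A]$ is the column dependence matroid of $A$: its ground set is the set of column indices $\{1,\dots,n\}$, and a set of indices is independent iff the corresponding columns form a linearly independent family. All matroids are finite; $M=(E,I)$ has ground set $E$ and collection of independent sets $I$. A matroid is $\mathbb{F}_q$-representable if it is isomorphic to $M[A]$ for some matrix $A$ over $\mathbb{F}_q$. A loop is an element belonging to no basis. A matroid is free if every subset of its ground set is independent, and non-free otherwise. "$M$ is a minor of $N$" means that $M$ is isomorphic to a matroid obtained from $N$ by a sequence of deletions and contractions. *)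

theory Defs
  imports
    "HOL-Probability.Probability_Mass_Function"
    "Jordan_Normal_Form.VS_Connect"
begin

section \<open>Finite matroids\<close>

record 'e set_system =
  ground :: "'e set"
  indeps :: "'e set set"

definition matroid :: "'e set_system \<Rightarrow> bool" where
  "matroid M \<longleftrightarrow>
     finite (ground M) \<and> indeps M \<subseteq> Pow (ground M) \<and> {} \<in> indeps M \<and>
     (\<forall>X Y. X \<in> indeps M \<longrightarrow> Y \<subseteq> X \<longrightarrow> Y \<in> indeps M) \<and>
     (\<forall>X Y. X \<in> indeps M \<longrightarrow> Y \<in> indeps M \<longrightarrow> card X < card Y \<longrightarrow>
        (\<exists>y \<in> Y - X. insert y X \<in> indeps M))"

definition basis_of :: "'e set_system \<Rightarrow> 'e set \<Rightarrow> 'e set \<Rightarrow> bool" where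
  "basis_of M X B \<longleftrightarrow>
     B \<subseteq> X \<and> B \<in> indeps M \<and> (\<forall>C. B \<subseteq> C \<longrightarrow> C \<subseteq> X \<longrightarrow> C \<in> indeps M \<longrightarrow> C = B)"

abbreviation basis :: "'e set_system \<Rightarrow> 'e set \<Rightarrow> bool" where
  "basis M \<equiv> basis_of M (ground M)"

definition matroid_rank :: "'e set_system \<Rightarrow> nat" where
  "matroid_rank M = Max (card ` indeps M)"

definition loops :: "'e set_system \<Rightarrow> 'e set" where
  "loops M = {e \<in> ground M. \<forall>B. basis M B \<longrightarrow> e \<notin> B}"

definition free_matroid :: "'e set_system \<Rightarrow> bool" where
  "free_matroid M \<longleftrightarrow> (\<forall>X. X \<subseteq> ground M \<longrightarrow> X \<in> indeps M)"

definition isomorphic :: "'e set_system \<Rightarrow> 'f set_system \<Rightarrow> bool" where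
  "isomorphic M N \<longleftrightarrow>
     (\<exists>f. bij_betw f (ground M) (ground N) \<and>
          (\<forall>X. X \<subseteq> ground M \<longrightarrow> (X \<in> indeps M \<longleftrightarrow> f ` X \<in> indeps N)))"

definition delete :: "'e set_system \<Rightarrow> 'e set \<Rightarrow> 'e set_system" where
  "delete M T = \<lparr> ground = ground M - T, indeps = {X \<in> indeps M. X \<subseteq> ground M - T} \<rparr>"

text \<open>For a matroid, the independent sets of a contraction do not depend on the choice of
  the basis \<open>B\<close> of the contracted set \<open>T\<close>.\<close>

definition contract :: "'e set_system \<Rightarrow> 'e set \<Rightarrow> 'e set_system" where
  "contract M T =
     \<lparr> ground = ground M - T,
       indeps = {X. X \<subseteq> ground M - T \<and> (\<exists>B. basis_of M T B \<and> X \<union> B \<in> indeps M)} \<rparr>"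

inductive reduces_to :: "'e set_system \<Rightarrow> 'e set_system \<Rightarrow> bool" for N where
  refl: "reduces_to N N"
| del: "reduces_to N K \<Longrightarrow> T \<subseteq> ground K \<Longrightarrow> reduces_to N (delete K T)"
| con: "reduces_to N K \<Longrightarrow> T \<subseteq> ground K \<Longrightarrow> reduces_to N (contract K T)"

definition minor_of :: "'e set_system \<Rightarrow> 'f set_system \<Rightarrow> bool" where
  "minor_of M N \<longleftrightarrow> (\<exists>K. reduces_to N K \<and> isomorphic M K)"

lemma card_basis_eq_matroid_rank:
  assumes M: "matroid M" and B: "basis M B"
  shows "card B = matroid_rank M"
proof -
  have fin: "finite (indeps M)"
    using M unfolding matroid_def by (auto intro: finite_subset[of _ "Pow (ground M)"])
  have BI: "B \<in> indeps M" using B unfolding basis_of_def by blast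
  have "card X \<le> card B" if X: "X \<in> indeps M" for X
  proof (rule ccontr)
    assume "\<not> card X \<le> card B"
    then have "card B < card X" by simp
    then obtain y where y: "y \<in> X - B" "insert y B \<in> indeps M"
      using M BI X unfolding matroid_def by blast
    then have "insert y B \<subseteq> ground M" using M unfolding matroid_def by blast
    then have "insert y B = B" using B y unfolding basis_of_def by blast
    then show False using y by blast
  qed
  then show ?thesis
    unfolding matroid_rank_def using fin BI by (intro Max_eqI[symmetric]) auto
qed


section \<open>Matroids of matrices\<close>

text \<open>The columns of a matrix are numbered from \<open>0\<close>. Linear independence of the columns
  indexed by \<open>S\<close> is that of a family, so equal columns at different indices are
  dependent; since \<^const>\<open>module.lin_dep\<close> is about sets of vectors,
  injectivity has to be required separately.\<close>

definition column_matroid :: "'a::field mat \<Rightarrow> nat set_system" where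
  "column_matroid A =
     \<lparr> ground = {..<dim_col A},
       indeps = {S. S \<subseteq> {..<dim_col A} \<and> inj_on (col A) S \<and>
                    \<not> module.lin_dep class_ring (module_vec TYPE('a) (dim_row A)) (col A ` S)} \<rparr>"

definition representable :: "'a::field itself \<Rightarrow> 'e set_system \<Rightarrow> bool" where
  "representable _ M \<longleftrightarrow> (\<exists>A :: 'a mat. isomorphic M (column_matroid A))"

lemma indeps_column_matroid_iff:
  fixes A :: "'a::field mat"
  shows "S \<in> indeps (column_matroid A) \<longleftrightarrow>
    S \<subseteq> {..<dim_col A} \<and>
    (\<forall>c. (\<forall>i<dim_row A. (\<Sum>j\<in>S. c j * A $$ (i, j)) = 0) \<longrightarrow> (\<forall>j\<in>S. c j = 0))"
proof (cases "S \<subseteq> {..<dim_col A}")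
  case False
  then show ?thesis by (simp add: column_matroid_def)
next
  case S: True
  interpret vec_space "TYPE('a)" "dim_row A" .
  have fS: "finite S" using S finite_subset by blast
  have carr: "col A ` S \<subseteq> carrier_vec (dim_row A)" by auto
  have lc: "vec_index (lincomb a (col A ` S)) i = (\<Sum>j\<in>S. a (col A j) * A $$ (i, j))"
    if inj: "inj_on (col A) S" and i: "i < dim_row A" for a i
  proof -
    have "vec_index (lincomb a (col A ` S)) i = (\<Sum>x\<in>col A ` S. a x * vec_index x i)"
      by (rule lincomb_index[OF i carr])
    also have "\<dots> = (\<Sum>j\<in>S. a (col A j) * vec_index (col A j) i)"
      by (simp add: sum.reindex[OF inj])
    also have "\<dots> = (\<Sum>j\<in>S. a (col A j) * A $$ (i, j))"
      by (rule sum.cong) (use S i in auto)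
    finally show ?thesis .
  qed
  let ?R = "\<forall>c. (\<forall>i<dim_row A. (\<Sum>j\<in>S. c j * A $$ (i, j)) = 0) \<longrightarrow> (\<forall>j\<in>S. c j = 0)"
  have "(inj_on (col A) S \<and> lin_indpt (col A ` S)) = ?R"
  proof
    assume L: "inj_on (col A) S \<and> lin_indpt (col A ` S)"
    show ?R
    proof (intro allI impI ballI)
      fix c j
      assume z: "\<forall>i<dim_row A. (\<Sum>j\<in>S. c j * A $$ (i, j)) = 0" and j: "j \<in> S"
      define a where "a = (\<lambda>x. c (the_inv_into S (col A) x))"
      have ac: "a (col A j) = c j" if "j \<in> S" for j
        using L that by (simp add: a_def the_inv_into_f_f)
      have "lincomb a (col A ` S) = 0\<^sub>v (dim_row A)"
      proof (rule eq_vecI)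
        fix i assume i: "i < dim_vec (0\<^sub>v (dim_row A) :: 'a vec)"
        then have "vec_index (lincomb a (col A ` S)) i = (\<Sum>j\<in>S. a (col A j) * A $$ (i, j))"
          using lc L by simp
        also have "\<dots> = (\<Sum>j\<in>S. c j * A $$ (i, j))" by (rule sum.cong) (simp_all add: ac)
        finally show "vec_index (lincomb a (col A ` S)) i = vec_index (0\<^sub>v (dim_row A)) i" using z i by simp
      qed (use lincomb_dim[of "col A ` S" a] fS carr in simp)
      then have "a (col A j) = 0"
        using L j fS carr unfolding lin_dep_def by blast
      then show "c j = 0" using ac j by simp
    qed
  next
    assume R: ?R
    have inj: "inj_on (col A) S"
    proof (rule inj_onI, rule ccontr)
      fix j k assume jk: "j \<in> S" "k \<in> S" "col A j = col A k" "j \<noteq> k"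
      define c :: "nat \<Rightarrow> 'a" where "c = (\<lambda>l. if l = j then 1 else if l = k then - 1 else 0)"
      have "(\<Sum>l\<in>S. c l * A $$ (i, l)) = 0" if i: "i < dim_row A" for i
      proof -
        have "(\<Sum>l\<in>S. c l * A $$ (i, l)) = (\<Sum>l\<in>{j, k}. c l * A $$ (i, l))"
          by (rule sum.mono_neutral_right) (use fS jk in \<open>auto simp: c_def\<close>)
        also have "\<dots> = A $$ (i, j) - A $$ (i, k)" using jk by (simp add: c_def)
        also have "A $$ (i, j) = vec_index (col A j) i"
          using i jk(1) S by (simp add: subset_eq)
        also have "\<dots> = A $$ (i, k)" unfolding jk(3) using i jk(2) S by (simp add: subset_eq)
        finally show ?thesis by simp
      qed
      then have "c j = 0" using R jk by blast
      then show False by (simp add: c_def)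
    qed
    moreover have "lin_indpt (col A ` S)"
    proof
      assume "lin_dep (col A ` S)"
      then obtain a v where a: "lincomb a (col A ` S) = 0\<^sub>v (dim_row A)" "v \<in> col A ` S" "a v \<noteq> 0"
        using finite_lin_dep[of "col A ` S"] fS carr by auto
      have "(\<Sum>j\<in>S. a (col A j) * A $$ (i, j)) = 0" if "i < dim_row A" for i
        using lc[OF inj that, of a] a(1) that by simp
      then have "\<forall>j\<in>S. a (col A j) = 0" using R[rule_format, of "\<lambda>j. a (col A j)"] by blast
      then show False using a by blast
    qed
    ultimately show "inj_on (col A) S \<and> lin_indpt (col A ` S)" by blast
  qed
  then show ?thesis using S by (simp add: column_matroid_def)
qed


section \<open>Uniform random matrices\<close>

text \<open>\<^const>\<open>pmf_of_set\<close> is only meaningful on finite nonempty sets.\<close>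

lemma finite_carrier_mat: "finite (carrier_mat m n :: 'a::finite mat set)"
proof -
  let ?F = "({..<m} \<times> {..<n}) \<rightarrow>\<^sub>E (UNIV :: 'a set)"
  have "carrier_mat m n \<subseteq> (\<lambda>f. mat m n f) ` ?F"
  proof
    fix A :: "'a mat" assume A: "A \<in> carrier_mat m n"
    define f where "f = restrict (\<lambda>ij. A $$ ij) ({..<m} \<times> {..<n})"
    have "A = mat m n f"
      by (rule eq_matI) (use A in \<open>auto simp: f_def\<close>)
    moreover have "f \<in> ?F" unfolding f_def by (rule restrict_PiE_iff[THEN iffD2], rule ballI, rule UNIV_I)
    ultimately show "A \<in> (\<lambda>f. mat m n f) ` ?F" by (rule image_eqI)
  qed
  moreover have "finite ((\<lambda>f. mat m n f) ` ?F)"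
    by (rule finite_imageI, rule finite_PiE)
      (rule finite_cartesian_product finite_lessThan finite)+
  ultimately show ?thesis by (rule finite_subset)
qed

lemma carrier_mat_nonempty: "carrier_mat m n \<noteq> {}"
proof -
  have "mat m n (\<lambda>_. undefined) \<in> carrier_mat m n" by (rule mat_carrier)
  then show ?thesis by (rule ex_in_conv[THEN iffD1, OF exI])
qed

definition uniform_mat :: "nat \<Rightarrow> nat \<Rightarrow> 'a::{finite,field} mat pmf" where
  "uniform_mat m n = pmf_of_set (carrier_mat m n)"

text \<open>The truncated subtractions on \<^typ>\<open>nat\<close> are exact, as the number of loops plus the
  rank of a matroid never exceeds the size of its ground set.\<close>

definition minor_prob_bound :: "nat \<Rightarrow> nat \<Rightarrow> 'e set_system \<Rightarrow> real" where
  "minor_prob_bound s q M =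
     (let e = card (ground M); r = matroid_rank M; l = card (loops M) in
      real (e choose l) * ((real q - 1) ^ (e - r - l) / real q ^ (s * (e - r))) *
      (\<Prod>i<r. 1 - real q powi (int i - int s)))"

end

theory Submission
  imports Defs
begin

text \<open>Write \<open>e = |E|\<close>, \<open>r = r(M)\<close>, \<open>k = e - r \<ge> 1\<close> and represent \<open>M\<close> by \<open>[I | D]\<close>.

  If \<open>m\<close> stays bounded, a random \<open>m \<times> n\<close> matrix contains all columns of \<open>[I | D]\<close> with
  probability tending to \<open>1\<close>.

  If \<open>m\<close> is large, it suffices to consider \<open>n = m + 1\<close> columns. Call a \<open>k \<times> n\<close> matrix \<open>G\<close> good
  if it contains all columns of \<open>[- D\<^sup>T | I]\<close>; almost all \<open>G\<close> are good. If the kernel of \<open>A\<close> is the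
  row space of a good \<open>G\<close>, then contracting the remaining columns of \<open>A\<close> yields \<open>M\<close>. There are at
  least \<open>\<Prod>i<n-k. q^m - q^i\<close> such \<open>A\<close> for each \<open>G\<close> and at most \<open>\<Prod>i<k. q^k - q^i\<close> such \<open>G\<close> for
  each \<open>A\<close>, so double counting bounds the probability from below, asymptotically, by
  \<open>q^(-k(k-1)) (\<Prod>j=k..m. 1 - q^(-j)) / (\<Prod>j=1..k. 1 - q^(-j))\<close>.
  Comparing with the claimed bound leaves
  \<open>(e choose l) (q-1)^(k-l) (\<Prod>j=1..k. 1 - q^(-j)) < q^(rk) (\<Prod>j=e+1..m. 1 - q^(-j))\<close>
  uniformly in \<open>m\<close>.\<close>

section \<open>Counting linearly independent families\<close>

text \<open>Vectors are extensional functions, so that they are equal as soon as their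
  \<open>m\<close> entries agree and the set of all of them is finite over a finite field.\<close>

abbreviation fvec :: "nat \<Rightarrow> (nat \<Rightarrow> 'a) set" where
  "fvec m \<equiv> {..<m} \<rightarrow>\<^sub>E UNIV"

lemma card_fvec: "card (fvec m :: (nat \<Rightarrow> 'a::finite) set) = CARD('a) ^ m"
  by (simp add: card_PiE)

lemma finite_fvec: "finite (fvec m :: (nat \<Rightarrow> 'a::finite) set)"
  by (simp add: finite_PiE)

lemma card_field_ge_2: "2 \<le> CARD('a::{finite,field})"
proof -
  have "card {0, 1 :: 'a} \<le> CARD('a)" by (intro card_mono) auto
  then show ?thesis by simp
qed

text \<open>The coefficients \<open>c\<close> are a total function whose values outside
  \<open>S\<close> do not matter; \<open>f\<close> is an indexed family, so repeated vectors count
  as dependent.\<close>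

definition lin_rel :: "nat \<Rightarrow> 'j set \<Rightarrow> ('j \<Rightarrow> nat \<Rightarrow> 'a::field) \<Rightarrow> ('j \<Rightarrow> 'a) \<Rightarrow> bool" where
  "lin_rel m S f c \<longleftrightarrow> (\<forall>i<m. (\<Sum>j\<in>S. c j * f j i) = 0)"

definition lin_indep :: "nat \<Rightarrow> 'j set \<Rightarrow> ('j \<Rightarrow> nat \<Rightarrow> 'a::field) \<Rightarrow> bool" where
  "lin_indep m S f \<longleftrightarrow> (\<forall>c. lin_rel m S f c \<longrightarrow> (\<forall>j\<in>S. c j = 0))"

definition combination :: "nat \<Rightarrow> 'j set \<Rightarrow> ('j \<Rightarrow> nat \<Rightarrow> 'a::field) \<Rightarrow> ('j \<Rightarrow> 'a) \<Rightarrow> nat \<Rightarrow> 'a" where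
  "combination m S f c = (\<lambda>i\<in>{..<m}. \<Sum>j\<in>S. c j * f j i)"

lemma combination_in_fvec: "combination m S f c \<in> fvec m"
  by (simp add: combination_def)

lemma inj_on_combination:
  assumes "lin_indep m S f"
  shows "inj_on (combination m S f) (S \<rightarrow>\<^sub>E UNIV)"
proof (rule inj_onI)
  fix c d assume c: "c \<in> S \<rightarrow>\<^sub>E UNIV" and d: "d \<in> S \<rightarrow>\<^sub>E UNIV"
    and eq: "combination m S f c = combination m S f d"
  have "lin_rel m S f (\<lambda>j. c j - d j)"
    unfolding lin_rel_def
  proof (intro allI impI)
    fix i assume "i < m"
    then show "(\<Sum>j\<in>S. (c j - d j) * f j i) = 0"
      using fun_cong[OF eq, of i]
      by (simp add: combination_def left_diff_distrib sum_subtractf)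
  qed
  then have "\<forall>j\<in>S. c j = d j" using assms unfolding lin_indep_def by auto
  then show "c = d" using PiE_ext[OF c d] by blast
qed

lemma card_combinations:
  fixes f :: "'j \<Rightarrow> nat \<Rightarrow> 'a::{finite,field}"
  assumes "finite S" "lin_indep m S f"
  shows "card (combination m S f ` (S \<rightarrow>\<^sub>E UNIV)) = CARD('a) ^ card S"
  by (simp add: card_image[OF inj_on_combination[OF assms(2)]] card_PiE assms(1))

text \<open>A relation with a nonzero coefficient at \<open>x\<close> can be solved for
  \<open>v\<close>, and one with coefficient zero at \<open>x\<close> is a relation on
  \<open>S\<close>. The update \<open>f(x := v)\<close> matches how families on
  \<open>insert x S\<close> are built up when they are counted.\<close>

lemma lin_indep_insert:
  assumes S: "finite S" "x \<notin> S" and v: "v \<in> fvec m"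
  shows "lin_indep m (insert x S) (f(x := v)) \<longleftrightarrow>
    lin_indep m S f \<and> v \<notin> combination m S f ` (S \<rightarrow>\<^sub>E UNIV)"
proof -
  have sm: "(\<Sum>j\<in>insert x S. c j * (f(x := v)) j i) = c x * v i + (\<Sum>j\<in>S. c j * f j i)" for c i
  proof -
    have "(\<Sum>j\<in>S. c j * (f(x := v)) j i) = (\<Sum>j\<in>S. c j * f j i)"
      by (rule sum.cong) (use S in auto)
    then show ?thesis using S by simp
  qed
  show ?thesis
  proof
    assume L: "lin_indep m (insert x S) (f(x := v))"
    have "lin_indep m S f"
      unfolding lin_indep_def lin_rel_def
    proof (intro allI impI)
      fix c assume c: "\<forall>i<m. (\<Sum>j\<in>S. c j * f j i) = 0"
      have "(\<Sum>j\<in>S. (c(x := 0)) j * f j i) = (\<Sum>j\<in>S. c j * f j i)" for i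
        by (rule sum.cong) (use S in auto)
      then have "lin_rel m (insert x S) (f(x := v)) (c(x := 0))"
        using c unfolding lin_rel_def sm by simp
      then show "\<forall>j\<in>S. c j = 0" using L S unfolding lin_indep_def
        by (metis fun_upd_other insertCI)
    qed
    moreover have "v \<notin> combination m S f ` (S \<rightarrow>\<^sub>E UNIV)"
    proof
      assume "v \<in> combination m S f ` (S \<rightarrow>\<^sub>E UNIV)"
      then obtain c where c: "v = combination m S f c" by blast
      \<comment> \<open>The coefficient \<open>- 1\<close> at \<open>x\<close> turns the
        representation of \<open>v\<close> into a relation.\<close>
      have "(\<Sum>j\<in>S. (c(x := - 1)) j * f j i) = (\<Sum>j\<in>S. c j * f j i)" for i
        by (rule sum.cong) (use S in auto)
      then have "lin_rel m (insert x S) (f(x := v)) (c(x := - 1))"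
        unfolding lin_rel_def sm by (simp add: c combination_def)
      then have "(c(x := - 1)) x = 0" using L unfolding lin_indep_def by blast
      then show False by simp
    qed
    ultimately show "lin_indep m S f \<and> v \<notin> combination m S f ` (S \<rightarrow>\<^sub>E UNIV)" by blast
  next
    assume R: "lin_indep m S f \<and> v \<notin> combination m S f ` (S \<rightarrow>\<^sub>E UNIV)"
    show "lin_indep m (insert x S) (f(x := v))"
      unfolding lin_indep_def
    proof (intro allI impI)
      fix c assume "lin_rel m (insert x S) (f(x := v)) c"
      then have c: "c x * v i + (\<Sum>j\<in>S. c j * f j i) = 0" if "i < m" for i
        using that unfolding lin_rel_def sm by blast
      have "c x = 0"
      proof (rule ccontr)
        assume nz: "c x \<noteq> 0"
        define d where "d = (\<lambda>j\<in>S. - c j / c x)"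
        have "v = combination m S f d"
        proof (rule PiE_ext[OF v combination_in_fvec])
          fix i assume "i \<in> {..<m}"
          have "(\<Sum>j\<in>S. d j * f j i) = (\<Sum>j\<in>S. c j * f j i) * (- 1 / c x)"
            unfolding sum_distrib_right by (rule sum.cong) (auto simp: d_def)
          also have "(\<Sum>j\<in>S. c j * f j i) = - (c x * v i)"
            using c \<open>i \<in> {..<m}\<close> by (simp add: eq_neg_iff_add_eq_0 add.commute)
          finally show "v i = combination m S f d i"
            using \<open>i \<in> {..<m}\<close> nz by (simp add: combination_def)
        qed
        moreover have "d \<in> S \<rightarrow>\<^sub>E UNIV" by (simp add: d_def)
        ultimately show False using R by blast
      qed
      moreover have "\<forall>j\<in>S. c j = 0"
        using R c \<open>c x = 0\<close> unfolding lin_indep_def lin_rel_def by simp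
      ultimately show "\<forall>j\<in>insert x S. c j = 0" by blast
    qed
  qed
qed

text \<open>The vectors are chosen one after another: after \<open>i\<close> independent ones, the
  next must avoid their \<open>q^i\<close> combinations, where \<open>q\<close> is the field size.
  For \<open>card S > m\<close> the factor with \<open>i = m\<close> vanishes, as it should.\<close>

lemma card_lin_indep:
  fixes S :: "'j set"
  assumes "finite S"
  shows "card {f \<in> S \<rightarrow>\<^sub>E fvec m. lin_indep m S (f :: 'j \<Rightarrow> nat \<Rightarrow> 'a::{finite,field})} =
    (\<Prod>i<card S. CARD('a) ^ m - CARD('a) ^ i)"
  using assms
proof (induction S rule: finite_induct)
  case empty
  then show ?case by (simp add: lin_indep_def)
next
  case (insert x S)
  let ?X = "{f \<in> S \<rightarrow>\<^sub>E fvec m. lin_indep m S (f :: 'j \<Rightarrow> nat \<Rightarrow> 'a)}"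
  let ?Y = "SIGMA f : ?X. fvec m - combination m S f ` (S \<rightarrow>\<^sub>E UNIV)"
  let ?h = "\<lambda>(f, v). f(x := v)"
  have fin: "finite (S \<rightarrow>\<^sub>E (fvec m :: (nat \<Rightarrow> 'a) set))"
    using insert.hyps finite_fvec by (intro finite_PiE) auto
  have "{f \<in> insert x S \<rightarrow>\<^sub>E fvec m. lin_indep m (insert x S) (f :: 'j \<Rightarrow> nat \<Rightarrow> 'a)} = ?h ` ?Y"
  proof (intro equalityI subsetI)
    fix f :: "'j \<Rightarrow> nat \<Rightarrow> 'a"
    assume f: "f \<in> {f \<in> insert x S \<rightarrow>\<^sub>E fvec m. lin_indep m (insert x S) f}"
    then obtain v g where vg: "v \<in> fvec m" "g \<in> S \<rightarrow>\<^sub>E fvec m" "f = g(x := v)"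
      by (auto simp: PiE_insert_eq)
    then have "(g, v) \<in> ?Y"
      using f lin_indep_insert[OF insert.hyps vg(1), of g] by simp
    then show "f \<in> ?h ` ?Y" using vg(3) by (rule_tac image_eqI) auto
  next
    fix f assume "f \<in> ?h ` ?Y"
    then obtain g v where *: "g \<in> S \<rightarrow>\<^sub>E fvec m" "lin_indep m S g"
      "v \<in> fvec m" "v \<notin> combination m S g ` (S \<rightarrow>\<^sub>E UNIV)" "f = g(x := v)" by auto
    then have "f \<in> insert x S \<rightarrow>\<^sub>E fvec m" unfolding PiE_insert_eq by auto
    then show "f \<in> {f \<in> insert x S \<rightarrow>\<^sub>E fvec m. lin_indep m (insert x S) f}"
      using lin_indep_insert[OF insert.hyps *(3), of g] * by simp
  qed
  moreover have "inj_on ?h ?Y"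
  proof (rule inj_onI, clarify)
    fix g v g' v'
    assume g: "g \<in> S \<rightarrow>\<^sub>E fvec m" "g' \<in> S \<rightarrow>\<^sub>E (fvec m :: (nat \<Rightarrow> 'a) set)"
      and eq: "g(x := v) = g'(x := v')"
    have "g = g'"
    proof (rule PiE_ext[OF g])
      fix y assume "y \<in> S"
      then show "g y = g' y" using fun_cong[OF eq, of y] insert.hyps by (auto split: if_splits)
    qed
    moreover have "v = v'" using fun_cong[OF eq, of x] by simp
    ultimately show "g = g' \<and> v = v'" by simp
  qed
  ultimately have "card {f \<in> insert x S \<rightarrow>\<^sub>E fvec m. lin_indep m (insert x S) (f :: 'j \<Rightarrow> nat \<Rightarrow> 'a)} = card ?Y"
    by (simp add: card_image)
  also have "\<dots> = (\<Sum>f\<in>?X. card (fvec m - combination m S f ` (S \<rightarrow>\<^sub>E UNIV)))"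
    by (rule card_SigmaI) (use fin finite_fvec in auto)
  also have "\<dots> = (\<Sum>f\<in>?X. CARD('a) ^ m - CARD('a) ^ card S)"
  proof (rule sum.cong)
    fix f assume f: "f \<in> ?X"
    have "finite (combination m S f ` (S \<rightarrow>\<^sub>E UNIV))"
      using insert.hyps by (intro finite_imageI finite_PiE) auto
    moreover have "combination m S f ` (S \<rightarrow>\<^sub>E UNIV) \<subseteq> fvec m"
      using combination_in_fvec by (intro image_subsetI combination_in_fvec)
    ultimately have "card (fvec m - combination m S f ` (S \<rightarrow>\<^sub>E UNIV)) =
        card (fvec m :: (nat \<Rightarrow> 'a) set) - card (combination m S f ` (S \<rightarrow>\<^sub>E UNIV))"
      by (rule card_Diff_subset)
    also have "\<dots> = CARD('a) ^ m - CARD('a) ^ card S"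
      using f card_combinations[OF insert.hyps(1), of m f] unfolding card_fvec by simp
    finally show "card (fvec m - combination m S f ` (S \<rightarrow>\<^sub>E UNIV)) = CARD('a) ^ m - CARD('a) ^ card S" .
  qed simp
  also have "\<dots> = (\<Prod>i<card (insert x S). CARD('a) ^ m - CARD('a) ^ i)"
    using insert by simp
  finally show ?case .
qed

text \<open>Cutting \<open>{..<n}\<close> into \<open>e\<close> blocks of length \<open>n div e\<close>, a random sequence misses
  the value \<open>h x\<close> on the block of \<open>x\<close> with probability \<open>(1 - 1 / card V) ^ (n div e)\<close>.\<close>

lemma card_contains_pattern:
  fixes h :: "nat \<Rightarrow> 'v"
  assumes V: "finite V" and h: "\<And>x. x < e \<Longrightarrow> h x \<in> V"
  shows "real (card V) ^ n * (1 - real e * (1 - 1 / real (card V)) ^ (n div e)) \<le>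
    real (card {g \<in> {..<n} \<rightarrow>\<^sub>E V. \<exists>p. inj_on p {..<e} \<and> p ` {..<e} \<subseteq> {..<n} \<and> (\<forall>x<e. g (p x) = h x)})"
    (is "_ \<le> real (card ?G)")
proof (cases "e = 0")
  \<comment> \<open>Without a pattern \<open>V\<close> may be empty; otherwise \<open>h 0\<close>
    shows that it is not.\<close>
  case True
  then have "?G = {..<n} \<rightarrow>\<^sub>E V" by auto
  then show ?thesis using True by (simp add: card_PiE)
next
  case False
  define s where "s = n div e"
  define v where "v = card V"
  have v0: "v > 0" unfolding v_def using h[of 0] False V by (auto simp: card_gt_0_iff)
  have blk: "x * s + i < n" if "x < e" "i < s" for x i
  proof -
    have "x * s + i < (x + 1) * s" using that by simp
    also have "\<dots> \<le> e * s" using that by (intro mult_right_mono) auto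
    also have "\<dots> \<le> n" by (simp add: s_def)
    finally show ?thesis .
  qed
  let ?P = "{..<n} \<rightarrow>\<^sub>E V"
  let ?B = "\<lambda>x. {g \<in> ?P. \<forall>i<s. g (x * s + i) \<noteq> h x}"
  have fP: "finite ?P" using V by (intro finite_PiE) auto
  have cP: "card ?P = v ^ n" by (simp add: card_PiE v_def)
  have sub: "?P - ?G \<subseteq> (\<Union>x<e. ?B x)"
  proof
    fix g assume g: "g \<in> ?P - ?G"
    show "g \<in> (\<Union>x<e. ?B x)"
    proof (rule ccontr)
      assume "g \<notin> (\<Union>x<e. ?B x)"
      then have "\<forall>x\<in>{..<e}. \<exists>i. i < s \<and> g (x * s + i) = h x" using g by blast
      then obtain f where f: "\<forall>x\<in>{..<e}. f x < s \<and> g (x * s + f x) = h x"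
        by (rule bchoice[elim_format]) blast
      \<comment> \<open>Distinct pattern entries are found in distinct blocks, and division by
        \<open>s\<close> recovers the block number.\<close>
      have "inj_on (\<lambda>x. x * s + f x) {..<e}"
      proof (rule inj_onI)
        fix x y assume xy: "x \<in> {..<e}" "y \<in> {..<e}" "x * s + f x = y * s + f y"
        have "f x < s" "f y < s" using f xy(1,2) by blast+
        then have "(x * s + f x) div s = x" "(y * s + f y) div s = y"
          by simp_all
        then show "x = y" unfolding xy(3) by (rule trans[OF sym])
      qed
      moreover have "(\<lambda>x. x * s + f x) ` {..<e} \<subseteq> {..<n}" using f blk by auto
      ultimately have "g \<in> ?G" using g f by blast
      then show False using g by blast
    qed
  qed
  have cB: "card (?B x) \<le> (v - 1) ^ s * v ^ (n - s)" if x: "x < e" for x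
  proof -
    let ?I = "{x * s..<x * s + s}"
    have I: "?I \<subseteq> {..<n}"
    proof
      fix i assume "i \<in> ?I"
      then show "i \<in> {..<n}" using blk[OF x, of "i - x * s"] by auto
    qed
    \<comment> \<open>Missing \<open>h x\<close> on its block leaves one value fewer at each of the
      \<open>s\<close> positions of the block and all values elsewhere.\<close>
    have "?B x \<subseteq> (\<Pi>\<^sub>E i\<in>{..<n}. if i \<in> ?I then V - {h x} else V)"
    proof
      fix g assume g: "g \<in> ?B x"
      have "g i \<noteq> h x" if "i \<in> ?I" for i
      proof -
        have "i - x * s < s" "x * s + (i - x * s) = i" using that by auto
        moreover have "\<forall>i<s. g (x * s + i) \<noteq> h x" using g by blast
        ultimately show ?thesis by metis
      qed
      then show "g \<in> (\<Pi>\<^sub>E i\<in>{..<n}. if i \<in> ?I then V - {h x} else V)"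
        using g by (auto simp: PiE_iff)
    qed
    then have "card (?B x) \<le> card (\<Pi>\<^sub>E i\<in>{..<n}. if i \<in> ?I then V - {h x} else V)"
      using V by (intro card_mono finite_PiE) auto
    also have "\<dots> = (\<Prod>i<n. if i \<in> ?I then v - 1 else v)"
      using V h[OF x] by (simp add: card_PiE v_def if_distrib cong: if_cong)
    also have "\<dots> = (v - 1) ^ card ?I * v ^ card ({..<n} - ?I)"
    proof -
      have "(\<Prod>i<n. if i \<in> ?I then v - 1 else v) =
        (\<Prod>i\<in>{..<n} \<inter> {i. i \<in> ?I}. v - 1) * (\<Prod>i\<in>{..<n} \<inter> - {i. i \<in> ?I}. v)"
        by (rule prod.If_cases) simp
      moreover have "{..<n} \<inter> {i. i \<in> ?I} = ?I" using I by auto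
      moreover have "{..<n} \<inter> - {i. i \<in> ?I} = {..<n} - ?I" by auto
      ultimately show ?thesis by simp
    qed
    also have "card ({..<n} - ?I) = n - s" using I by (subst card_Diff_subset) auto
    finally show ?thesis by simp
  qed
  have sn: "s \<le> n" unfolding s_def by simp
  have "card (?P - ?G) \<le> card (\<Union>x<e. ?B x)" using sub fP by (intro card_mono) auto
  also have "\<dots> \<le> (\<Sum>x<e. card (?B x))" by (rule card_UN_le) simp
  also have "\<dots> \<le> (\<Sum>x<e. (v - 1) ^ s * v ^ (n - s))" using cB by (intro sum_mono) auto
  finally have bad: "card (?P - ?G) \<le> e * ((v - 1) ^ s * v ^ (n - s))" by simp
  have "real v ^ n * (1 - 1 / real v) ^ s = real v ^ (n - s) * (real v * (1 - 1 / real v)) ^ s"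
    by (simp add: power_mult_distrib power_add[symmetric] sn)
  also have "real v * (1 - 1 / real v) = real (v - 1)"
    using v0 by (simp add: right_diff_distrib of_nat_diff)
  finally have "real v ^ n * (1 - 1 / real v) ^ s = real ((v - 1) ^ s * v ^ (n - s))" by simp
  then have "real v ^ n * (1 - real e * (1 - 1 / real v) ^ s) = real (card ?P) - real (e * ((v - 1) ^ s * v ^ (n - s)))"
    unfolding cP right_diff_distrib by (simp add: algebra_simps)
  also have "\<dots> \<le> real (card ?P) - real (card (?P - ?G))" using bad by linarith
  also have "\<dots> = real (card ?G)"
  proof -
    have "card ?P = card (?P - ?G) + card ?G"
      using fP card_Diff_subset[of ?G ?P] card_mono[OF fP, of ?G] by (auto simp: finite_subset)
    then show ?thesis by linarith
  qed
  finally show ?thesis by (simp add: v_def s_def)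
qed

text \<open>The block length \<open>n div e\<close> tends to infinity, and the base
  \<open>1 - 1 / v\<close> lies in \<open>[0, 1)\<close>.\<close>

lemma pattern_bound_tendsto:
  assumes "e > 0" "v > 0"
  shows "(\<lambda>n. 1 - real e * (1 - 1 / real v) ^ (n div e)) \<longlonglongrightarrow> 1"
proof -
  have "filterlim (\<lambda>n. n div e) at_top sequentially"
    unfolding filterlim_at_top
  proof
    fix Z
    show "\<forall>\<^sub>F n in sequentially. Z \<le> n div e"
      using eventually_ge_at_top[of "Z * e"]
      by eventually_elim (use assms in \<open>simp add: less_eq_div_iff_mult_less_eq\<close>)
  qed
  moreover have "(\<lambda>n. (1 - 1 / real v) ^ n) \<longlonglongrightarrow> 0"
    using assms by (intro LIMSEQ_abs_realpow_zero2) (auto simp: field_simps)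
  ultimately have "(\<lambda>n. (1 - 1 / real v) ^ (n div e)) \<longlonglongrightarrow> 0"
    by (rule filterlim_compose[rotated])
  then show ?thesis by (auto intro!: tendsto_eq_intros)
qed

section \<open>Minors of column matroids\<close>

text \<open>The first argument of \<open>a\<close> is the column index: \<open>a\<close> is the
  family of columns, so it can be used directly in \<open>lin_indep\<close>.\<close>

definition mat_of :: "nat \<Rightarrow> nat \<Rightarrow> (nat \<Rightarrow> nat \<Rightarrow> 'a) \<Rightarrow> 'a mat" where
  "mat_of m n a = mat m n (\<lambda>(i, j). a j i)"

lemma ground_mat_of [simp]: "ground (column_matroid (mat_of m n a)) = {..<n}"
  by (simp add: column_matroid_def mat_of_def)

lemma indeps_mat_of_iff_lin_indep:
  assumes "S \<subseteq> {..<n}"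
  shows "S \<in> indeps (column_matroid (mat_of m n a)) \<longleftrightarrow> lin_indep m S a"
proof -
  have "(\<Sum>j\<in>S. c j * mat_of m n a $$ (i, j)) = (\<Sum>j\<in>S. c j * a j i)" if "i < m" for c i
    by (rule sum.cong) (use assms that in \<open>auto simp: mat_of_def\<close>)
  then show ?thesis
    using assms by (simp add: indeps_column_matroid_iff lin_indep_def lin_rel_def mat_of_def)
qed

text \<open>Relations on \<open>S\<close> are extended by zero to \<open>T\<close>. In this form
  independence depends only on the space of relations of the whole family, which is what the
  constructions of minors compare.\<close>

lemma lin_indep_iff_supported:
  assumes "finite T" "S \<subseteq> T"
  shows "lin_indep m S a \<longleftrightarrow>
    (\<forall>c. lin_rel m T a c \<and> (\<forall>j\<in>T - S. c j = 0) \<longrightarrow> (\<forall>j\<in>T. c j = 0))"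
proof -
  have sm: "(\<Sum>j\<in>T. c j * a j i) = (\<Sum>j\<in>S. c j * a j i)" if "\<forall>j\<in>T - S. c j = 0" for c i
    by (rule sum.mono_neutral_right) (use assms that in auto)
  show ?thesis
  proof
    assume L: "lin_indep m S a"
    show "\<forall>c. lin_rel m T a c \<and> (\<forall>j\<in>T - S. c j = 0) \<longrightarrow> (\<forall>j\<in>T. c j = 0)"
      using L unfolding lin_indep_def lin_rel_def by (metis DiffI sm)
  next
    assume R: "\<forall>c. lin_rel m T a c \<and> (\<forall>j\<in>T - S. c j = 0) \<longrightarrow> (\<forall>j\<in>T. c j = 0)"
    show "lin_indep m S a"
      unfolding lin_indep_def
    proof (intro allI impI)
      fix c assume c: "lin_rel m S a c"
      define d where "d = (\<lambda>j. if j \<in> S then c j else 0)"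
      have "(\<Sum>j\<in>S. d j * a j i) = (\<Sum>j\<in>S. c j * a j i)" for i
        by (rule sum.cong) (auto simp: d_def)
      then have "lin_rel m T a d"
        using c sm[of d] by (simp add: lin_rel_def d_def)
      moreover have "\<forall>j\<in>T - S. d j = 0" by (simp add: d_def)
      ultimately have "\<forall>j\<in>T. d j = 0" using R by blast
      then show "\<forall>j\<in>S. c j = 0" using assms(2) by (metis d_def subsetD)
    qed
  qed
qed

lemma indeps_mat_of_iff:
  assumes "S \<subseteq> {..<n}"
  shows "S \<in> indeps (column_matroid (mat_of m n a)) \<longleftrightarrow>
    (\<forall>c. lin_rel m {..<n} a c \<and> (\<forall>j\<in>{..<n} - S. c j = 0) \<longrightarrow> (\<forall>j\<in>{..<n}. c j = 0))"
  unfolding indeps_mat_of_iff_lin_indep[OF assms]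
  by (rule lin_indep_iff_supported[OF finite_lessThan assms])

section \<open>Matroids in standard form and their relation spaces\<close>

definition std_rel :: "nat \<Rightarrow> nat \<Rightarrow> (nat \<Rightarrow> nat \<Rightarrow> 'a::field) \<Rightarrow> (nat \<Rightarrow> 'a) \<Rightarrow> bool" where
  "std_rel r k D c \<longleftrightarrow> (\<forall>b<r. c b + (\<Sum>t<k. c (r + t) * D b t) = 0)"

text \<open>The matroid of the columns of the block matrix \<open>[I | D]\<close>, whose linear relations are given
  by \<^const>\<open>std_rel\<close>, is isomorphic to \<open>M\<close> via \<open>\<phi>\<close>.\<close>

definition std_rep ::
  "'e set_system \<Rightarrow> (nat \<Rightarrow> 'e) \<Rightarrow> nat \<Rightarrow> nat \<Rightarrow> (nat \<Rightarrow> nat \<Rightarrow> 'a::field) \<Rightarrow> bool" where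
  "std_rep M \<phi> r k D \<longleftrightarrow> bij_betw \<phi> {..<r + k} (ground M) \<and>
     (\<forall>Y \<subseteq> {..<r + k}. \<phi> ` Y \<in> indeps M \<longleftrightarrow>
        (\<forall>c. std_rel r k D c \<and> (\<forall>x\<in>{..<r + k} - Y. c x = 0) \<longrightarrow> (\<forall>x\<in>{..<r + k}. c x = 0)))"

text \<open>Both matroids are labelled by a common index set \<open>I\<close>, and the isomorphism
  is \<open>p\<close> after the inverse of \<open>\<phi>\<close>. Only the independence of labelled
  sets remains to be compared.\<close>

lemma isomorphic_via:
  assumes \<phi>: "bij_betw \<phi> I (ground M)" and p: "inj_on p I" and K: "ground K = p ` I"
    and eq: "\<And>Y. Y \<subseteq> I \<Longrightarrow> p ` Y \<in> indeps K \<longleftrightarrow> \<phi> ` Y \<in> indeps M"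
  shows "isomorphic M K"
proof -
  let ?\<psi> = "the_inv_into I \<phi>"
  have \<psi>: "bij_betw ?\<psi> (ground M) I" by (rule bij_betw_the_inv_into[OF \<phi>])
  have "bij_betw (p \<circ> ?\<psi>) (ground M) (ground K)"
    using bij_betw_trans[OF \<psi>, of p] p unfolding K by (simp add: inj_on_imp_bij_betw)
  moreover have "X \<in> indeps M \<longleftrightarrow> (p \<circ> ?\<psi>) ` X \<in> indeps K" if X: "X \<subseteq> ground M" for X
  proof -
    have "?\<psi> ` X \<subseteq> I" using \<psi> X by (auto simp: bij_betw_def)
    moreover have "\<phi> ` ?\<psi> ` X = X"
    proof -
      have "\<phi> (?\<psi> x) = x" if "x \<in> X" for x
        using that X \<phi> by (intro f_the_inv_into_f_bij_betw[OF \<phi>]) auto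
      then show ?thesis by (force simp: image_image)
    qed
    ultimately show ?thesis using eq[of "?\<psi> ` X"] by (simp add: image_comp)
  qed
  ultimately show ?thesis unfolding isomorphic_def by blast
qed

lemma sum_lessThan_add:
  fixes r k :: nat
  shows "(\<Sum>x<r + k. F x) = (\<Sum>x<r. F x) + (\<Sum>t<k. F (r + t) :: 'b::comm_monoid_add)"
  by (induction k) (simp_all add: add.assoc)

text \<open>The columns of \<open>[I | D]\<close>, padded by zero rows, and of \<open>[- D\<^sup>T | I]\<close>, whose rows span the
  relations \<^const>\<open>std_rel\<close>.\<close>

definition std_col :: "nat \<Rightarrow> (nat \<Rightarrow> nat \<Rightarrow> 'a) \<Rightarrow> nat \<Rightarrow> nat \<Rightarrow> 'a::field" where
  "std_col r D x i = (if x < r then if x = i then 1 else 0 else if i < r then D i (x - r) else 0)"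

definition dual_col :: "nat \<Rightarrow> (nat \<Rightarrow> nat \<Rightarrow> 'a) \<Rightarrow> nat \<Rightarrow> nat \<Rightarrow> 'a::field" where
  "dual_col r D x t = (if x < r then - D x t else if x - r = t then 1 else 0)"

text \<open>The rows from \<open>r\<close> on are zero and contribute trivial equations.\<close>

lemma std_rel_iff_std_col:
  assumes "r \<le> m"
  shows "std_rel r k D d \<longleftrightarrow> (\<forall>i<m. (\<Sum>x<r + k. d x * std_col r D x i) = 0)"
proof -
  have "(\<Sum>x<r + k. d x * std_col r D x i) =
    (if i < r then d i + (\<Sum>t<k. d (r + t) * D i t) else 0)" for i
  proof -
    have "(\<Sum>x<r. d x * std_col r D x i) = (\<Sum>x<r. if x = i then d x else 0)"
      by (rule sum.cong) (auto simp: std_col_def)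
    then show ?thesis unfolding sum_lessThan_add by (simp add: std_col_def)
  qed
  then show ?thesis using assms by (auto simp: std_rel_def)
qed

text \<open>This is the duality between \<open>[I | D]\<close> and \<open>[- D\<^sup>T | I]\<close>:
  the last \<open>k\<close> entries of a relation are free, determine the first \<open>r\<close>,
  and serve as the coefficients \<open>u\<close>.\<close>

lemma std_rel_iff_dual_col:
  "std_rel r k D d \<longleftrightarrow> (\<exists>u. \<forall>x<r + k. d x = (\<Sum>t<k. u t * dual_col r D x t))"
proof -
  have low: "(\<Sum>t<k. u t * dual_col r D x t) = - (\<Sum>t<k. u t * D x t)" if "x < r" for u x
    using that by (simp add: dual_col_def sum_negf)
  have high: "(\<Sum>t<k. u t * dual_col r D (r + s) t) = u s" if "s < k" for u s
  proof -
    have "(\<Sum>t<k. u t * dual_col r D (r + s) t) = (\<Sum>t<k. if s = t then u t else 0)"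
      by (rule sum.cong) (auto simp: dual_col_def)
    then show ?thesis using that by simp
  qed
  show ?thesis
  proof
    assume d: "std_rel r k D d"
    have "d x = (\<Sum>t<k. d (r + t) * dual_col r D x t)" if x: "x < r + k" for x
    proof (cases "x < r")
      case True
      then show ?thesis using d unfolding low[OF True] std_rel_def by (simp add: eq_neg_iff_add_eq_0)
    next
      case False
      define s where "s = x - r"
      have s: "x = r + s" "s < k" using False x unfolding s_def by linarith+
      show ?thesis unfolding s(1) by (rule high[OF s(2), symmetric])
    qed
    then show "\<exists>u. \<forall>x<r + k. d x = (\<Sum>t<k. u t * dual_col r D x t)"
      by (intro exI[of _ "\<lambda>t. d (r + t)"] allI impI)
  next
    assume "\<exists>u. \<forall>x<r + k. d x = (\<Sum>t<k. u t * dual_col r D x t)"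
    then obtain u where u: "\<And>x. x < r + k \<Longrightarrow> d x = (\<Sum>t<k. u t * dual_col r D x t)" by blast
    have "d (r + t) = u t" if "t < k" for t using u[of "r + t"] high that by simp
    then show "std_rel r k D d" using u low by (simp add: std_rel_def)
  qed
qed

text \<open>The minor is obtained by deleting all columns outside the range of \<open>p\<close>.
  Relations supported on that range correspond under \<open>p\<close> to the relations of
  \<open>[I | D]\<close>.\<close>

lemma minor_of_if_std_cols:
  assumes rep: "std_rep M \<phi> r k D" and rm: "r \<le> m"
    and p: "inj_on p {..<r + k}" "p ` {..<r + k} \<subseteq> {..<n}"
    and a: "\<And>x i. x < r + k \<Longrightarrow> i < m \<Longrightarrow> a (p x) i = std_col r D x i"
  shows "minor_of M (column_matroid (mat_of m n a))"
proof -
  let ?N = "column_matroid (mat_of m n a)"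
  let ?E = "p ` {..<r + k}"
  let ?K = "delete ?N ({..<n} - ?E)"
  have gK: "ground ?K = ?E" using p(2) by (auto simp: delete_def)
  have rel: "lin_rel m {..<n} a c \<longleftrightarrow> std_rel r k D (\<lambda>x. c (p x))"
    if c: "\<forall>j\<in>{..<n} - ?E. c j = 0" for c
  proof -
    have "(\<Sum>j<n. c j * a j i) = (\<Sum>x<r + k. c (p x) * std_col r D x i)" if "i < m" for i
    proof -
      have "(\<Sum>j<n. c j * a j i) = (\<Sum>j\<in>?E. c j * a j i)"
        by (rule sum.mono_neutral_right) (use p c in auto)
      also have "\<dots> = (\<Sum>x<r + k. c (p x) * a (p x) i)"
        using p(1) by (simp add: sum.reindex)
      also have "\<dots> = (\<Sum>x<r + k. c (p x) * std_col r D x i)"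
        by (rule sum.cong) (use a that in auto)
      finally show ?thesis .
    qed
    then show ?thesis by (simp add: lin_rel_def std_rel_iff_std_col[OF rm])
  qed
  have "isomorphic M ?K"
  proof (rule isomorphic_via[OF _ p(1) gK])
    show "bij_betw \<phi> {..<r + k} (ground M)" using rep by (simp add: std_rep_def)
    fix Y assume Y: "Y \<subseteq> {..<r + k}"
    have pY: "p ` Y \<subseteq> {..<n}" using p(2) Y by blast
    have "p ` Y \<in> indeps ?K \<longleftrightarrow> p ` Y \<in> indeps ?N" using Y p(2) by (auto simp: delete_def)
    also have "\<dots> \<longleftrightarrow> (\<forall>c. lin_rel m {..<n} a c \<and> (\<forall>j\<in>{..<n} - p ` Y. c j = 0) \<longrightarrow> (\<forall>j\<in>{..<n}. c j = 0))"
      by (rule indeps_mat_of_iff[OF pY])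
    also have "\<dots> \<longleftrightarrow> (\<forall>d. std_rel r k D d \<and> (\<forall>x\<in>{..<r + k} - Y. d x = 0) \<longrightarrow> (\<forall>x\<in>{..<r + k}. d x = 0))"
      (is "?L \<longleftrightarrow> ?R")
    proof
      assume L: ?L
      show ?R
      proof (intro allI impI, elim conjE)
        fix d assume d: "std_rel r k D d" "\<forall>x\<in>{..<r + k} - Y. d x = 0"
        \<comment> \<open>The relation \<open>d\<close> is carried over along \<open>p\<close> and
          extended by zero to the other columns.\<close>
        define c where "c = (\<lambda>j. if j \<in> ?E then d (the_inv_into {..<r + k} p j) else 0)"
        have cp: "c (p x) = d x" if "x < r + k" for x
          using that p(1) by (simp add: c_def the_inv_into_f_f)
        have "std_rel r k D (\<lambda>x. c (p x))"
          using d(1) unfolding std_rel_def by (simp add: cp)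
        moreover have c0: "\<forall>j\<in>{..<n} - ?E. c j = 0" by (simp add: c_def)
        moreover have "\<forall>j\<in>{..<n} - p ` Y. c j = 0"
        proof
          fix j assume j: "j \<in> {..<n} - p ` Y"
          show "c j = 0"
          proof (cases "j \<in> ?E")
            case True
            then obtain x where x: "x < r + k" "j = p x" by auto
            then have "x \<notin> Y" using j by blast
            then show ?thesis using cp[OF x(1)] d(2) x by simp
          qed (use c0 j in blast)
        qed
        ultimately have "\<forall>j\<in>{..<n}. c j = 0"
          using L rel[OF c0] by metis
        then show "\<forall>x\<in>{..<r + k}. d x = 0" using cp p(2) by (metis image_subset_iff lessThan_iff)
      qed
    next
      assume R: ?R
      show ?L
      proof (intro allI impI, elim conjE)
        fix c assume c: "lin_rel m {..<n} a c" "\<forall>j\<in>{..<n} - p ` Y. c j = 0"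
        have c0: "\<forall>j\<in>{..<n} - ?E. c j = 0" using c(2) Y by blast
        have "std_rel r k D (\<lambda>x. c (p x))" using rel[OF c0] c(1) by blast
        moreover have "c (p x) = 0" if "x \<in> {..<r + k} - Y" for x
        proof -
          have "p x \<notin> p ` Y" using that p(1) Y by (auto dest!: inj_onD)
          then show ?thesis using c(2) that p(2) by blast
        qed
        ultimately have "\<forall>x\<in>{..<r + k}. c (p x) = 0" using R by blast
        then show "\<forall>j\<in>{..<n}. c j = 0" using c0 by blast
      qed
    qed
    also have "\<dots> \<longleftrightarrow> \<phi> ` Y \<in> indeps M" using rep Y by (simp add: std_rep_def)
    finally show "p ` Y \<in> indeps ?K \<longleftrightarrow> \<phi> ` Y \<in> indeps M" .
  qed
  moreover have "reduces_to ?N ?K" by (intro reduces_to.intros) auto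
  ultimately show ?thesis unfolding minor_of_def by blast
qed

lemma minor_of_if_dual_cols:
  assumes rep: "std_rep M \<phi> r k D"
    and p: "inj_on p {..<r + k}" "p ` {..<r + k} \<subseteq> {..<n}"
    and ker: "\<And>c. lin_rel m {..<n} a c \<longleftrightarrow> (\<exists>u. \<forall>j<n. c j = (\<Sum>t<k. u t * g j t))"
    and g: "\<And>x t. x < r + k \<Longrightarrow> t < k \<Longrightarrow> g (p x) t = dual_col r D x t"
  shows "minor_of M (column_matroid (mat_of m n a))"
proof -
  let ?N = "column_matroid (mat_of m n a)"
  let ?E = "p ` {..<r + k}"
  let ?C = "{..<n} - ?E"
  let ?K = "contract ?N ?C"
  have gsum: "(\<Sum>t<k. u t * g (p x) t) = (\<Sum>t<k. u t * dual_col r D x t)" if "x < r + k" for u x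
    by (rule sum.cong) (use g that in auto)
  have key: "p ` Y \<union> ?C \<in> indeps ?N \<longleftrightarrow>
      (\<forall>d. std_rel r k D d \<and> (\<forall>x\<in>{..<r + k} - Y. d x = 0) \<longrightarrow> (\<forall>x\<in>{..<r + k}. d x = 0))"
    (is "_ \<longleftrightarrow> ?R") if Y: "Y \<subseteq> {..<r + k}" for Y
  proof -
    have sub: "p ` Y \<union> ?C \<subseteq> {..<n}" using p(2) Y by blast
    have "p ` Y \<union> ?C \<in> indeps ?N \<longleftrightarrow>
      (\<forall>c. lin_rel m {..<n} a c \<and> (\<forall>j\<in>{..<n} - (p ` Y \<union> ?C). c j = 0) \<longrightarrow> (\<forall>j\<in>{..<n}. c j = 0))"
      (is "_ \<longleftrightarrow> ?L")
      by (rule indeps_mat_of_iff[OF sub])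
    also have "?L \<longleftrightarrow> ?R"
    proof
      assume L: ?L
      show ?R
      proof (intro allI impI, elim conjE)
        fix d assume d: "std_rel r k D d" "\<forall>x\<in>{..<r + k} - Y. d x = 0"
        obtain u where u: "\<And>x. x < r + k \<Longrightarrow> d x = (\<Sum>t<k. u t * dual_col r D x t)"
          using d(1) unfolding std_rel_iff_dual_col by blast
        define c where "c = (\<lambda>j. \<Sum>t<k. u t * g j t)"
        have cp: "c (p x) = d x" if "x < r + k" for x
          using that u gsum by (simp add: c_def)
        have "lin_rel m {..<n} a c" unfolding ker by (intro exI[of _ u]) (simp add: c_def)
        moreover have "\<forall>j\<in>{..<n} - (p ` Y \<union> ?C). c j = 0"
        proof
          fix j assume j: "j \<in> {..<n} - (p ` Y \<union> ?C)"
          then obtain x where x: "x < r + k" "j = p x" by auto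
          then have "x \<notin> Y" using j by blast
          then show "c j = 0" using cp[OF x(1)] d(2) x by simp
        qed
        ultimately have "\<forall>j\<in>{..<n}. c j = 0" using L by blast
        then show "\<forall>x\<in>{..<r + k}. d x = 0" using cp p(2) by (metis image_subset_iff lessThan_iff)
      qed
    next
      assume R: ?R
      show ?L
      proof (intro allI impI, elim conjE)
        fix c assume c: "lin_rel m {..<n} a c" "\<forall>j\<in>{..<n} - (p ` Y \<union> ?C). c j = 0"
        obtain u where u: "\<And>j. j < n \<Longrightarrow> c j = (\<Sum>t<k. u t * g j t)" using c(1) ker by blast
        have cu: "c (p x) = (\<Sum>t<k. u t * dual_col r D x t)" if "x < r + k" for x
          using u[of "p x"] gsum[OF that] p(2) that by auto
        have "std_rel r k D (\<lambda>x. c (p x))" unfolding std_rel_iff_dual_col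
          by (intro exI[of _ u] allI impI cu)
        moreover have "c (p x) = 0" if "x \<in> {..<r + k} - Y" for x
        proof -
          have "p x \<notin> p ` Y" using that p(1) Y by (auto dest!: inj_onD)
          then show ?thesis using c(2) that p(2) by blast
        qed
        ultimately have z: "\<forall>x\<in>{..<r + k}. c (p x) = 0" using R by blast
        \<comment> \<open>The identity block of the dual columns reads off \<open>u s\<close> as the
          entry of \<open>c\<close> at \<open>p (r + s)\<close>.\<close>
        have "u s = 0" if "s < k" for s
        proof -
          have "(\<Sum>t<k. u t * dual_col r D (r + s) t) = (\<Sum>t<k. if s = t then u t else 0)"
            by (rule sum.cong) (auto simp: dual_col_def)
          then show ?thesis using cu[of "r + s"] z that by simp
        qed
        then show "\<forall>j\<in>{..<n}. c j = 0" using u by simp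
      qed
    qed
    finally show ?thesis .
  qed
  \<comment> \<open>For empty \<open>Y\<close> the right side of \<open>key\<close> holds trivially.
    Hence the contracted set is independent and is its own only basis.\<close>
  have CI: "?C \<in> indeps ?N" using key[of "{}"] by simp
  then have bas: "basis_of ?N ?C B \<longleftrightarrow> B = ?C" for B
    unfolding basis_of_def by blast
  have gK: "ground ?K = ?E" using p(2) by (auto simp: contract_def)
  have "isomorphic M ?K"
  proof (rule isomorphic_via[OF _ p(1) gK])
    show "bij_betw \<phi> {..<r + k} (ground M)" using rep by (simp add: std_rep_def)
    fix Y assume Y: "Y \<subseteq> {..<r + k}"
    have "p ` Y \<in> indeps ?K \<longleftrightarrow> p ` Y \<union> ?C \<in> indeps ?N"
      using Y p(2) by (auto simp: contract_def bas)
    also have "\<dots> \<longleftrightarrow> \<phi> ` Y \<in> indeps M" using key[OF Y] rep Y by (simp add: std_rep_def)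
    finally show "p ` Y \<in> indeps ?K \<longleftrightarrow> \<phi> ` Y \<in> indeps M" .
  qed
  moreover have "reduces_to ?N ?K" by (intro reduces_to.intros) auto
  ultimately show ?thesis unfolding minor_of_def by blast
qed

lemma reduces_to_trans:
  assumes "reduces_to N K" "reduces_to K L"
  shows "reduces_to N L"
  using assms(2,1) by (induction rule: reduces_to.induct) (auto intro: reduces_to.intros)

text \<open>Deleting the columns from \<open>n\<close> on gives back the smaller matroid, and
  reductions compose.\<close>

lemma minor_of_mat_of_mono:
  assumes "minor_of M (column_matroid (mat_of m n a))" "n \<le> n'"
  shows "minor_of M (column_matroid (mat_of m n' a))"
proof -
  let ?N = "column_matroid (mat_of m n' a)" and ?L = "column_matroid (mat_of m n a)"
  have "ground (delete ?N {n..<n'}) = ground ?L"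
    using assms(2) by (auto simp: delete_def)
  moreover have "S \<in> indeps (delete ?N {n..<n'}) \<longleftrightarrow> S \<in> indeps ?L" for S
  proof (cases "S \<subseteq> {..<n}")
    case True
    moreover from True have "S \<subseteq> {..<n'}" using assms(2) by auto
    ultimately show ?thesis
      by (auto simp: delete_def indeps_mat_of_iff_lin_indep)
  next
    case False
    then show ?thesis by (auto simp: delete_def column_matroid_def mat_of_def)
  qed
  ultimately have "delete ?N {n..<n'} = ?L"
    by (simp add: set_system.equality set_eq_iff)
  moreover have "reduces_to ?N (delete ?N {n..<n'})"
    by (rule reduces_to.del[OF reduces_to.refl]) auto
  ultimately show ?thesis
    using assms(1) reduces_to_trans unfolding minor_of_def by metis
qed

section \<open>Counting matrices with a given minor\<close>

text \<open>Like \<open>a\<close>, the family \<open>g\<close> lists columns: \<open>g j t\<close>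
  is the entry in row \<open>t\<close> and column \<open>j\<close> of a \<open>k\<close> by
  \<open>n\<close> matrix whose row space is the kernel of \<open>a\<close>.\<close>

definition kernel_rows ::
  "nat \<Rightarrow> nat \<Rightarrow> nat \<Rightarrow> (nat \<Rightarrow> nat \<Rightarrow> 'a::field) \<Rightarrow> (nat \<Rightarrow> nat \<Rightarrow> 'a) \<Rightarrow> bool" where
  "kernel_rows m n k a g \<longleftrightarrow>
     (\<forall>c. lin_rel m {..<n} a c \<longleftrightarrow> (\<exists>u. \<forall>j<n. c j = (\<Sum>t<k. u t * g j t)))"

text \<open>An identity submatrix certifies that the \<open>k\<close> rows are linearly independent
  and singles out \<open>k\<close> coordinates that determine each element of the row space.\<close>

definition has_unit_cols :: "nat \<Rightarrow> nat \<Rightarrow> (nat \<Rightarrow> nat \<Rightarrow> 'a::field) \<Rightarrow> bool" where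
  "has_unit_cols n k g \<longleftrightarrow>
     (\<exists>\<tau>. inj_on \<tau> {..<k} \<and> \<tau> ` {..<k} \<subseteq> {..<n} \<and>
        (\<forall>s<k. \<forall>t<k. g (\<tau> s) t = (if s = t then 1 else 0)))"

lemma finite_families: "finite S \<Longrightarrow> finite (S \<rightarrow>\<^sub>E (fvec m :: (nat \<Rightarrow> 'a::finite) set))"
  by (intro finite_PiE finite_fvec)

lemma sum_unit_col:
  fixes u :: "nat \<Rightarrow> 'a::field"
  assumes "\<And>t. t < k \<Longrightarrow> h t = (if s = t then 1 else 0)" "s < k"
  shows "(\<Sum>t<k. u t * h t) = u s"
proof -
  have "(\<Sum>t<k. u t * h t) = (\<Sum>t<k. if s = t then u t else 0)"
    by (rule sum.cong) (auto simp: assms(1))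
  then show ?thesis using assms(2) by simp
qed

text \<open>The \<open>n - k\<close> columns of \<open>a\<close> away from the unit positions may be
  any independent family. The remaining columns are then forced by the requirement that each row of
  \<open>g\<close> be a relation, and independence excludes further relations.\<close>

lemma card_with_kernel_rows_ge:
  fixes g :: "nat \<Rightarrow> nat \<Rightarrow> 'a::{finite,field}"
  assumes "has_unit_cols n k g"
  shows "(\<Prod>i<n - k. CARD('a) ^ m - CARD('a) ^ i) \<le>
    card {a \<in> {..<n} \<rightarrow>\<^sub>E fvec m. kernel_rows m n k a g}"
proof -
  obtain \<tau> where \<tau>: "inj_on \<tau> {..<k}" "\<tau> ` {..<k} \<subseteq> {..<n}"
    and unit: "\<And>s t. s < k \<Longrightarrow> t < k \<Longrightarrow> g (\<tau> s) t = (if s = t then 1 else 0)"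
    using assms unfolding has_unit_cols_def by blast
  define T where "T = {..<n} - \<tau> ` {..<k}"
  have cT: "card T = n - k"
    unfolding T_def using \<tau> by (simp add: card_Diff_subset card_image)
  have fT: "finite T" by (simp add: T_def)
  \<comment> \<open>Row \<open>s\<close> of \<open>g\<close> has coefficient one at
    \<open>\<tau> s\<close> and zero at the other unit positions, so as a relation it can be solved
    for column \<open>\<tau> s\<close>.\<close>
  define ext :: "(nat \<Rightarrow> nat \<Rightarrow> 'a) \<Rightarrow> nat \<Rightarrow> nat \<Rightarrow> 'a" where
    "ext f = (\<lambda>j\<in>{..<n}. if j \<in> T then f j else
       (\<lambda>i\<in>{..<m}. - (\<Sum>l\<in>T. g l (the_inv_into {..<k} \<tau> j) * f l i)))" for f
  let ?F = "{f \<in> T \<rightarrow>\<^sub>E fvec m. lin_indep m T (f :: nat \<Rightarrow> nat \<Rightarrow> 'a)}"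
  have extT: "ext f j = f j" if "j \<in> T" for f j using that by (simp add: ext_def T_def)
  have ext\<tau>: "ext f (\<tau> s) i = - (\<Sum>l\<in>T. g l s * f l i)" if "s < k" "i < m" for f s i
  proof -
    have "\<tau> s < n" "\<tau> s \<notin> T" using that \<tau>(2) by (auto simp: T_def)
    then show ?thesis using that \<tau>(1) by (simp add: ext_def the_inv_into_f_f)
  qed
  \<comment> \<open>Subtracting from \<open>c\<close> the combination of the rows of
    \<open>g\<close> with coefficients \<open>c (\<tau> s)\<close> clears the unit positions and
    leaves a relation on \<open>T\<close> alone.\<close>
  have split: "(\<Sum>j<n. c j * ext f j i) = (\<Sum>l\<in>T. (c l - (\<Sum>s<k. c (\<tau> s) * g l s)) * f l i)"
    if "i < m" for c f i
  proof -
    have "(\<Sum>j<n. c j * ext f j i) =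
        (\<Sum>l\<in>T. c l * ext f l i) + (\<Sum>j\<in>\<tau> ` {..<k}. c j * ext f j i)"
      unfolding T_def by (rule sum.subset_diff) (use \<tau> in auto)
    also have "(\<Sum>l\<in>T. c l * ext f l i) = (\<Sum>l\<in>T. c l * f l i)"
      by (rule sum.cong) (auto simp: extT)
    also have "(\<Sum>j\<in>\<tau> ` {..<k}. c j * ext f j i) = (\<Sum>s<k. c (\<tau> s) * ext f (\<tau> s) i)"
      using \<tau>(1) by (simp add: sum.reindex)
    also have "\<dots> = (\<Sum>s<k. \<Sum>l\<in>T. - (c (\<tau> s) * g l s * f l i))"
      by (rule sum.cong) (use that in \<open>auto simp: ext\<tau> sum_distrib_left sum_negf mult.assoc\<close>)
    also have "\<dots> = (\<Sum>l\<in>T. - (\<Sum>s<k. c (\<tau> s) * g l s) * f l i)"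
      by (subst sum.swap) (simp add: sum_distrib_right sum_negf)
    finally show ?thesis
      by (simp add: sum.distrib[symmetric] algebra_simps)
  qed
  have rows: "kernel_rows m n k (ext f) g" if f: "lin_indep m T f" for f
    unfolding kernel_rows_def
  proof (intro allI iffI)
    fix c assume "lin_rel m {..<n} (ext f) c"
    then have "lin_rel m T f (\<lambda>l. c l - (\<Sum>s<k. c (\<tau> s) * g l s))"
      unfolding lin_rel_def by (simp add: split)
    then have T0: "c l = (\<Sum>s<k. c (\<tau> s) * g l s)" if "l \<in> T" for l
      using f that unfolding lin_indep_def by fastforce
    show "\<exists>u. \<forall>j<n. c j = (\<Sum>t<k. u t * g j t)"
    proof (intro exI[of _ "\<lambda>s. c (\<tau> s)"] allI impI)
      fix j assume "j < n"
      show "c j = (\<Sum>t<k. c (\<tau> t) * g j t)"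
      proof (cases "j \<in> T")
        case False
        then obtain s where s: "s < k" "j = \<tau> s" using \<open>j < n\<close> by (auto simp: T_def)
        then show ?thesis using sum_unit_col[of k "g (\<tau> s)" s "\<lambda>t. c (\<tau> t)"] unit by simp
      qed (rule T0)
    qed
  next
    fix c assume "\<exists>u. \<forall>j<n. c j = (\<Sum>t<k. u t * g j t)"
    then obtain u where u: "\<And>j. j < n \<Longrightarrow> c j = (\<Sum>t<k. u t * g j t)" by blast
    have "c (\<tau> s) = u s" if "s < k" for s
    proof -
      have "\<tau> s < n" using \<tau>(2) that by auto
      then show ?thesis using u sum_unit_col[of k "g (\<tau> s)" s u] unit that by simp
    qed
    then have "c l = (\<Sum>s<k. c (\<tau> s) * g l s)" if "l \<in> T" for l
      using u that by (simp add: T_def)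
    then show "lin_rel m {..<n} (ext f) c"
      unfolding lin_rel_def by (simp add: split)
  qed
  have "inj_on ext ?F"
  proof (rule inj_onI)
    fix f f' assume f: "f \<in> ?F" "f' \<in> ?F" and eq: "ext f = ext f'"
    show "f = f'"
    proof (rule PiE_ext[of _ T "\<lambda>_. fvec m"])
      fix l assume "l \<in> T"
      then show "f l = f' l" using extT eq by metis
    qed (use f in auto)
  qed
  moreover have "ext ` ?F \<subseteq> {a \<in> {..<n} \<rightarrow>\<^sub>E fvec m. kernel_rows m n k a g}"
  proof
    fix a assume "a \<in> ext ` ?F"
    then obtain f where f: "f \<in> T \<rightarrow>\<^sub>E fvec m" "lin_indep m T f" "a = ext f" by blast
    have "ext f \<in> {..<n} \<rightarrow>\<^sub>E fvec m"
      unfolding ext_def using f(1) by (intro restrict_PiE_iff[THEN iffD2]) (auto simp: PiE_mem)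
    then show "a \<in> {a \<in> {..<n} \<rightarrow>\<^sub>E fvec m. kernel_rows m n k a g}"
      using rows f by blast
  qed
  moreover have "finite {a \<in> {..<n} \<rightarrow>\<^sub>E fvec m. kernel_rows m n k a g}"
    by (simp add: finite_families)
  ultimately have "card ?F \<le> card {a \<in> {..<n} \<rightarrow>\<^sub>E fvec m. kernel_rows m n k a g}"
    by (rule card_inj_on_le)
  then show ?thesis using card_lin_indep[OF fT, of m, where 'a = 'a] cT by simp
qed

text \<open>All such \<open>g\<close> have the same row space. Expressing their rows through those
  of one fixed \<open>h\<close> gives a coefficient matrix \<open>U\<close>, which determines
  \<open>g\<close> and has independent rows; there are as many candidates for \<open>U\<close> as
  invertible \<open>k\<close> by \<open>k\<close> matrices.\<close>

lemma card_kernel_rows_le: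
  fixes a :: "nat \<Rightarrow> nat \<Rightarrow> 'a::{finite,field}"
  shows "card {g \<in> {..<n} \<rightarrow>\<^sub>E fvec k. has_unit_cols n k g \<and> kernel_rows m n k a g} \<le>
    (\<Prod>i<k. CARD('a) ^ k - CARD('a) ^ i)"
proof (cases "{g \<in> {..<n} \<rightarrow>\<^sub>E fvec k. has_unit_cols n k g \<and> kernel_rows m n k a g} = {}")
  case True
  show ?thesis unfolding True by simp
next
  case False
  let ?G = "{g \<in> {..<n} \<rightarrow>\<^sub>E fvec k. has_unit_cols n k g \<and> kernel_rows m n k a g}"
  let ?F = "{f \<in> {..<k} \<rightarrow>\<^sub>E fvec k. lin_indep k {..<k} (f :: nat \<Rightarrow> nat \<Rightarrow> 'a)}"
  obtain h where h: "kernel_rows m n k a h" using False by blast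
  have ex: "\<exists>U. U \<in> {..<k} \<rightarrow>\<^sub>E fvec k \<and> (\<forall>j<n. \<forall>t<k. g j t = (\<Sum>s<k. U t s * h j s))"
    if g: "g \<in> ?G" for g
  proof -
    have "\<exists>u. \<forall>j<n. g j t = (\<Sum>s<k. u s * h j s)" if t: "t < k" for t
    proof -
      have "(\<Sum>s<k. (if s = t then 1 else 0) * g j s) = g j t" for j
        using t by (simp add: if_distrib[of "\<lambda>x. x * _"] cong: if_cong)
      then have "\<exists>u. \<forall>j<n. g j t = (\<Sum>s<k. u s * g j s)"
        by (intro exI[of _ "\<lambda>s. if s = t then 1 else 0"]) simp
      then have "lin_rel m {..<n} a (\<lambda>j. g j t)" using g unfolding kernel_rows_def by simp
      then show ?thesis using h unfolding kernel_rows_def by simp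
    qed
    then obtain U where U: "\<And>t j. t < k \<Longrightarrow> j < n \<Longrightarrow> g j t = (\<Sum>s<k. U t s * h j s)" by metis
    have "(\<lambda>t\<in>{..<k}. \<lambda>s\<in>{..<k}. U t s) \<in> {..<k} \<rightarrow>\<^sub>E fvec k" by simp
    moreover have "\<forall>j<n. \<forall>t<k. g j t = (\<Sum>s<k. (\<lambda>t\<in>{..<k}. \<lambda>s\<in>{..<k}. U t s) t s * h j s)"
      by (simp add: U)
    ultimately show ?thesis by blast
  qed
  define \<Phi> where "\<Phi> g = (SOME U. U \<in> {..<k} \<rightarrow>\<^sub>E fvec k \<and>
    (\<forall>j<n. \<forall>t<k. g j t = (\<Sum>s<k. U t s * h j s)))" for g
  have \<Phi>: "\<Phi> g \<in> {..<k} \<rightarrow>\<^sub>E fvec k \<and> (\<forall>j<n. \<forall>t<k. g j t = (\<Sum>s<k. \<Phi> g t s * h j s))"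
    if "g \<in> ?G" for g
    unfolding \<Phi>_def by (rule someI_ex[OF ex[OF that]])
  have "inj_on \<Phi> ?G"
  proof (rule inj_onI)
    fix g g' assume g: "g \<in> ?G" "g' \<in> ?G" and eq: "\<Phi> g = \<Phi> g'"
    show "g = g'"
    proof (rule PiE_ext[of _ "{..<n}" "\<lambda>_. fvec k"])
      fix j assume j: "j \<in> {..<n}"
      show "g j = g' j"
      proof (rule PiE_ext[of _ "{..<k}" "\<lambda>_. UNIV"])
        fix t assume "t \<in> {..<k}"
        then show "g j t = g' j t" using \<Phi>[OF g(1)] \<Phi>[OF g(2)] eq j by simp
      qed (use g j in \<open>auto simp: PiE_mem\<close>)
    qed (use g in auto)
  qed
  moreover have "\<Phi> ` ?G \<subseteq> ?F"
  proof
    fix U assume "U \<in> \<Phi> ` ?G"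
    then obtain g where g: "g \<in> ?G" and U: "U = \<Phi> g" by blast
    obtain \<tau> where \<tau>: "\<tau> ` {..<k} \<subseteq> {..<n}"
      and unit: "\<And>s t. s < k \<Longrightarrow> t < k \<Longrightarrow> g (\<tau> s) t = (if s = t then 1 else 0)"
      using g unfolding has_unit_cols_def by blast
    \<comment> \<open>A relation \<open>c\<close> among the rows of \<open>U\<close> is also one
      among the rows of \<open>g\<close>, and its entry at the unit column \<open>\<tau> s\<close>
      is \<open>c s\<close>.\<close>
    have "lin_indep k {..<k} U"
      unfolding lin_indep_def
    proof (intro allI impI ballI)
      fix c s assume c: "lin_rel k {..<k} U c" and s: "s \<in> {..<k}"
      have j: "\<tau> s < n" using \<tau> s by auto
      have "c s = (\<Sum>t<k. c t * g (\<tau> s) t)"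
        using sum_unit_col[of k "g (\<tau> s)" s c] unit s by simp
      also have "\<dots> = (\<Sum>t<k. \<Sum>w<k. c t * U t w * h (\<tau> s) w)"
        by (rule sum.cong) (use \<Phi>[OF g] j in \<open>auto simp: U sum_distrib_left mult.assoc\<close>)
      also have "\<dots> = (\<Sum>w<k. (\<Sum>t<k. c t * U t w) * h (\<tau> s) w)"
        by (subst sum.swap) (simp add: sum_distrib_right)
      also have "\<dots> = 0" using c by (simp add: lin_rel_def)
      finally show "c s = 0" .
    qed
    then show "U \<in> ?F" using \<Phi>[OF g] U by blast
  qed
  moreover have "finite ?F"
    by (simp add: finite_families)
  ultimately have "card ?G \<le> card ?F" by (rule card_inj_on_le)
  then show ?thesis using card_lin_indep[of "{..<k}" k, where 'a = 'a] by simp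
qed

text \<open>The pairs related by \<open>R\<close> are counted once by each coordinate; an
  \<open>x\<close> without a partner contributes none.\<close>

lemma double_counting:
  fixes R :: "'x \<Rightarrow> 'y \<Rightarrow> bool"
  assumes fin: "finite X" "finite Y"
    and lower: "\<And>y. y \<in> Y \<Longrightarrow> c \<le> card {x \<in> X. R x y}"
    and upper: "\<And>x. x \<in> X \<Longrightarrow> card {y \<in> Y. R x y} \<le> d"
  shows "card Y * c \<le> card {x \<in> X. \<exists>y\<in>Y. R x y} * d"
proof -
  let ?X = "{x \<in> X. \<exists>y\<in>Y. R x y}"
  have "card Y * c = (\<Sum>y\<in>Y. c)" by simp
  also have "\<dots> \<le> (\<Sum>y\<in>Y. card {x \<in> ?X. R x y})"
  proof (rule sum_mono)
    fix y assume y: "y \<in> Y"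
    then have "{x \<in> X. R x y} = {x \<in> ?X. R x y}" by blast
    then show "c \<le> card {x \<in> ?X. R x y}" using lower[OF y] by simp
  qed
  also have "\<dots> = (\<Sum>x\<in>?X. card {y \<in> Y. R x y})"
    using sum.swap_restrict[of Y ?X "\<lambda>_ _. 1 :: nat" "\<lambda>y x. R x y"] fin by simp
  also have "\<dots> \<le> (\<Sum>x\<in>?X. d)" using upper by (intro sum_mono) auto
  finally show ?thesis by simp
qed

text \<open>Double counting of the pairs of a matrix \<open>a\<close> and a \<open>k\<close> by
  \<open>n\<close> matrix \<open>g\<close> that contains the pattern
  \<open>[- D\<^sup>T | I]\<close> and spans the kernel of \<open>a\<close>. The number of
  \<open>g\<close> is bounded by \<open>card_contains_pattern\<close> with the \<open>q^k\<close>
  vectors of length \<open>k\<close> as values, where \<open>q\<close> is the field size.\<close>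

lemma card_minor_dual_ge:
  fixes D :: "nat \<Rightarrow> nat \<Rightarrow> 'a::{finite,field}"
  assumes rep: "std_rep M \<phi> r k D"
  shows "real CARD('a) ^ (k * n) *
      (1 - real (r + k) * (1 - 1 / real CARD('a) ^ k) ^ (n div (r + k))) *
      real (\<Prod>i<n - k. CARD('a) ^ m - CARD('a) ^ i) \<le>
    real (card {a \<in> {..<n} \<rightarrow>\<^sub>E fvec m. minor_of M (column_matroid (mat_of m n (a :: nat \<Rightarrow> nat \<Rightarrow> 'a)))}) *
      real (\<Prod>i<k. CARD('a) ^ k - CARD('a) ^ i)"
proof -
  let ?h = "\<lambda>x. \<lambda>t\<in>{..<k}. dual_col r D x t"
  let ?G = "{g \<in> {..<n} \<rightarrow>\<^sub>E fvec k. \<exists>p. inj_on p {..<r + k} \<and> p ` {..<r + k} \<subseteq> {..<n} \<and>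
    (\<forall>x<r + k. g (p x) = ?h x)}"
  let ?X = "{..<n} \<rightarrow>\<^sub>E (fvec m :: (nat \<Rightarrow> 'a) set)"
  let ?c = "\<Prod>i<n - k. CARD('a) ^ m - CARD('a) ^ i" and ?d = "\<Prod>i<k. CARD('a) ^ k - CARD('a) ^ i"
  have fX: "finite ?X" by (simp add: finite_families)
  have fG: "finite ?G"
    by (simp add: finite_families)
  have unit: "has_unit_cols n k g" if g: "g \<in> ?G" for g
  proof -
    obtain p where p: "inj_on p {..<r + k}" "p ` {..<r + k} \<subseteq> {..<n}" "\<forall>x<r + k. g (p x) = ?h x"
      using g by (elim CollectE conjE exE) (rule that)
    \<comment> \<open>The last \<open>k\<close> pattern columns form the identity block, so they
      provide the unit columns.\<close>
    have "inj_on (\<lambda>s. p (r + s)) {..<k}"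
      using inj_onD[OF p(1)] by (intro inj_onI) fastforce
    moreover have "(\<lambda>s. p (r + s)) ` {..<k} \<subseteq> {..<n}"
      using p(2) by (intro image_subsetI) (simp add: image_subset_iff)
    moreover have "\<forall>s<k. \<forall>t<k. g (p (r + s)) t = (if s = t then 1 else 0)"
      using p(3) by (simp add: dual_col_def)
    ultimately show ?thesis unfolding has_unit_cols_def by blast
  qed
  have "card ?G * ?c \<le> card {a \<in> ?X. \<exists>g\<in>?G. kernel_rows m n k a g} * ?d"
  proof (rule double_counting[OF fX fG])
    fix g assume "g \<in> ?G"
    then show "?c \<le> card {a \<in> ?X. kernel_rows m n k a g}"
      by (intro card_with_kernel_rows_ge unit)
  next
    fix a :: "nat \<Rightarrow> nat \<Rightarrow> 'a"
    have "card {g \<in> ?G. kernel_rows m n k a g} \<le>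
      card {g \<in> {..<n} \<rightarrow>\<^sub>E fvec k. has_unit_cols n k g \<and> kernel_rows m n k a g}"
      using unit by (intro card_mono) (auto simp: finite_families)
    then show "card {g \<in> ?G. kernel_rows m n k a g} \<le> ?d"
      using card_kernel_rows_le[of n k m a] by linarith
  qed
  also have "\<dots> \<le> card {a \<in> ?X. minor_of M (column_matroid (mat_of m n a))} * ?d"
  proof (intro mult_right_mono card_mono)
    show "{a \<in> ?X. \<exists>g\<in>?G. kernel_rows m n k a g} \<subseteq> {a \<in> ?X. minor_of M (column_matroid (mat_of m n a))}"
    proof clarify
      fix a g p assume k: "kernel_rows m n k a g" and p: "inj_on p {..<r + k}" "p ` {..<r + k} \<subseteq> {..<n}"
        and g: "\<forall>x<r + k. g (p x) = ?h x"
      show "minor_of M (column_matroid (mat_of m n a))"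
      proof (rule minor_of_if_dual_cols[OF rep p])
        show "lin_rel m {..<n} a c \<longleftrightarrow> (\<exists>u. \<forall>j<n. c j = (\<Sum>t<k. u t * g j t))" for c
          using k unfolding kernel_rows_def by (rule spec)
      qed (use g in simp)
    qed
  qed (use fX in auto)
  finally have le: "card ?G * ?c \<le> card {a \<in> ?X. minor_of M (column_matroid (mat_of m n a))} * ?d" .
  have "real CARD('a) ^ (k * n) *
      (1 - real (r + k) * (1 - 1 / real CARD('a) ^ k) ^ (n div (r + k))) \<le> real (card ?G)"
    using card_contains_pattern[OF finite_fvec, of "r + k" ?h k n]
    by (simp add: card_fvec power_mult)
  then have "real CARD('a) ^ (k * n) *
      (1 - real (r + k) * (1 - 1 / real CARD('a) ^ k) ^ (n div (r + k))) * real ?c \<le> real (card ?G) * real ?c"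
    by (rule mult_right_mono) (rule of_nat_0_le_iff)
  also have "\<dots> = real (card ?G * ?c)" by simp
  also have "\<dots> \<le> real (card {a \<in> ?X. minor_of M (column_matroid (mat_of m n a))} * ?d)"
    using le by (rule of_nat_mono)
  finally show ?thesis by simp
qed

text \<open>Here the pattern is \<open>[I | D]\<close> itself, padded to height \<open>m\<close>.
  The number of column values grows with \<open>m\<close>, so this is useful for fixed
  \<open>m\<close> and large \<open>n\<close>.\<close>

lemma card_minor_std_ge:
  fixes D :: "nat \<Rightarrow> nat \<Rightarrow> 'a::{finite,field}"
  assumes rep: "std_rep M \<phi> r k D" and "r \<le> m"
  shows "real CARD('a) ^ (m * n) *
      (1 - real (r + k) * (1 - 1 / real CARD('a) ^ m) ^ (n div (r + k))) \<le>
    real (card {a \<in> {..<n} \<rightarrow>\<^sub>E fvec m. minor_of M (column_matroid (mat_of m n (a :: nat \<Rightarrow> nat \<Rightarrow> 'a)))})"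
proof -
  let ?h = "\<lambda>x. \<lambda>i\<in>{..<m}. std_col r D x i"
  let ?X = "{..<n} \<rightarrow>\<^sub>E (fvec m :: (nat \<Rightarrow> 'a) set)"
  let ?G = "{a \<in> ?X. \<exists>p. inj_on p {..<r + k} \<and> p ` {..<r + k} \<subseteq> {..<n} \<and>
    (\<forall>x<r + k. a (p x) = ?h x)}"
  have fX: "finite ?X" by (simp add: finite_families)
  have "?G \<subseteq> {a \<in> ?X. minor_of M (column_matroid (mat_of m n a))}"
  proof clarify
    fix a p assume p: "inj_on p {..<r + k}" "p ` {..<r + k} \<subseteq> {..<n}" and a: "\<forall>x<r + k. a (p x) = ?h x"
    show "minor_of M (column_matroid (mat_of m n a))"
      by (rule minor_of_if_std_cols[OF assms p]) (use a in simp)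
  qed
  then have "card ?G \<le> card {a \<in> ?X. minor_of M (column_matroid (mat_of m n a))}"
    using fX by (intro card_mono) auto
  moreover have "real CARD('a) ^ (m * n) *
      (1 - real (r + k) * (1 - 1 / real CARD('a) ^ m) ^ (n div (r + k))) \<le> real (card ?G)"
    using card_contains_pattern[OF finite_fvec, of "r + k" ?h m n]
    by (simp add: card_fvec power_mult)
  ultimately show ?thesis by linarith
qed

section \<open>From counts of column families to probabilities\<close>

lemma bij_betw_mat_of: "bij_betw (mat_of m n) ({..<n} \<rightarrow>\<^sub>E fvec m) (carrier_mat m n)"
proof (rule bij_betw_imageI)
  show "inj_on (mat_of m n) ({..<n} \<rightarrow>\<^sub>E (fvec m :: (nat \<Rightarrow> 'a) set))"
  proof (rule inj_onI)
    fix a b assume ab: "a \<in> {..<n} \<rightarrow>\<^sub>E (fvec m :: (nat \<Rightarrow> 'a) set)" "b \<in> {..<n} \<rightarrow>\<^sub>E fvec m"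
      and eq: "mat_of m n a = mat_of m n b"
    show "a = b"
    proof (rule PiE_ext[OF ab])
      fix j assume j: "j \<in> {..<n}"
      show "a j = b j"
      proof (rule PiE_ext[of _ "{..<m}" "\<lambda>_. UNIV"])
        fix i assume "i \<in> {..<m}"
        then show "a j i = b j i" using arg_cong[OF eq, of "\<lambda>A. A $$ (i, j)"] j by (simp add: mat_of_def)
      qed (use ab j in \<open>auto simp: PiE_mem\<close>)
    qed
  qed
  show "mat_of m n ` ({..<n} \<rightarrow>\<^sub>E (fvec m :: (nat \<Rightarrow> 'a) set)) = carrier_mat m n"
  proof (intro equalityI subsetI)
    fix A :: "'a mat" assume A: "A \<in> carrier_mat m n"
    then have "A = mat_of m n (\<lambda>j\<in>{..<n}. \<lambda>i\<in>{..<m}. A $$ (i, j))"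
      by (intro eq_matI) (auto simp: mat_of_def)
    then show "A \<in> mat_of m n ` ({..<n} \<rightarrow>\<^sub>E fvec m)"
      by (rule image_eqI[where f = "mat_of m n"]) simp
  qed (auto simp: mat_of_def)
qed

lemma prob_uniform_mat:
  "measure_pmf.prob (uniform_mat m n :: 'a::{finite,field} mat pmf) {A. P A} =
    real (card {a \<in> {..<n} \<rightarrow>\<^sub>E fvec m. P (mat_of m n a)}) / real CARD('a) ^ (m * n)"
proof -
  let ?X = "{..<n} \<rightarrow>\<^sub>E (fvec m :: (nat \<Rightarrow> 'a) set)"
  have b: "inj_on (mat_of m n) ?X" "mat_of m n ` ?X = (carrier_mat m n :: 'a mat set)"
    using bij_betw_mat_of[of m n, where 'a = 'a] by (auto simp: bij_betw_def)
  have "card (carrier_mat m n :: 'a mat set) = CARD('a) ^ (m * n)"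
    using card_image[OF b(1)] b(2) by (simp add: card_PiE card_fvec power_mult)
  moreover have "carrier_mat m n \<inter> {A. P A} = mat_of m n ` {a \<in> ?X. P (mat_of m n a)}"
    unfolding b(2)[symmetric] by blast
  then have "card (carrier_mat m n \<inter> {A. P A}) = card {a \<in> ?X. P (mat_of m n a)}"
    using inj_on_subset[OF b(1)] by (simp add: card_image)
  ultimately show ?thesis
    unfolding uniform_mat_def
    by (simp add: measure_pmf_of_set[OF carrier_mat_nonempty finite_carrier_mat])
qed

text \<open>Appending an arbitrary column preserves the minor. Each step therefore multiplies the
  number of favourable families by at least the number of vectors of length \<open>m\<close>, and
  the number of all families by exactly that factor. This reduces many columns to
  \<open>m + 1\<close>.\<close>

lemma prob_minor_mono:
  assumes "n \<le> n'"
  shows "measure_pmf.prob (uniform_mat m n :: 'a::{finite,field} mat pmf) {A. minor_of M (column_matroid A)} \<le>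
    measure_pmf.prob (uniform_mat m n' :: 'a mat pmf) {A. minor_of M (column_matroid A)}"
  using assms
proof (induction n' rule: dec_induct)
  case (step n')
  let ?Y = "\<lambda>n. {a \<in> {..<n} \<rightarrow>\<^sub>E fvec m. minor_of M (column_matroid (mat_of m n (a :: nat \<Rightarrow> nat \<Rightarrow> 'a)))}"
  let ?ext = "\<lambda>(v, a). a(n' := v)"
  have inj: "inj_on ?ext (fvec m \<times> ?Y n')"
    by (rule inj_on_subset[OF inj_combinator[of n' "{..<n'}" "\<lambda>_. fvec m"]]) auto
  have cong: "mat_of m n' (a(n' := v)) = mat_of m n' a" for a and v :: "nat \<Rightarrow> 'a"
    by (rule eq_matI) (auto simp: mat_of_def)
  have sub: "?ext ` (fvec m \<times> ?Y n') \<subseteq> ?Y (Suc n')"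
  proof clarify
    fix v :: "nat \<Rightarrow> 'a" and a :: "nat \<Rightarrow> nat \<Rightarrow> 'a"
    assume v: "v \<in> fvec m" and a: "a \<in> {..<n'} \<rightarrow>\<^sub>E fvec m"
      and M: "minor_of M (column_matroid (mat_of m n' a))"
    have "a(n' := v) \<in> {..<Suc n'} \<rightarrow>\<^sub>E fvec m"
      using v a by (auto simp: lessThan_Suc PiE_insert_eq)
    moreover have "minor_of M (column_matroid (mat_of m (Suc n') (a(n' := v))))"
      by (rule minor_of_mat_of_mono[of M m n']) (use M in \<open>simp_all add: cong\<close>)
    ultimately show "a(n' := v) \<in> {..<Suc n'} \<rightarrow>\<^sub>E fvec m \<and>
      minor_of M (column_matroid (mat_of m (Suc n') (a(n' := v))))" by blast
  qed
  have "finite (?Y (Suc n'))"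
    by (simp add: finite_families)
  then have "card (?ext ` (fvec m \<times> ?Y n')) \<le> card (?Y (Suc n'))"
    using sub by (rule card_mono)
  then have "CARD('a) ^ m * card (?Y n') \<le> card (?Y (Suc n'))"
    unfolding card_image[OF inj] by (simp add: card_cartesian_product card_fvec)
  then have "real (CARD('a) ^ m * card (?Y n')) \<le> real (card (?Y (Suc n')))"
    by (rule of_nat_mono)
  then have "real CARD('a) ^ m * real (card (?Y n')) \<le> real (card (?Y (Suc n')))"
    by (simp only: of_nat_mult of_nat_power)
  then have "real (card (?Y n')) / real CARD('a) ^ (m * n') \<le> real (card (?Y (Suc n'))) / real CARD('a) ^ (m * Suc n')"
    by (simp add: divide_simps power_add mult_ac)
  then show ?case using step.IH unfolding prob_uniform_mat by linarith
qed simp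

section \<open>Standard representations\<close>

lemma exists_basis:
  assumes M: "matroid M"
  obtains B where "basis M B"
proof -
  have fin: "finite (indeps M)"
    using M unfolding matroid_def by (auto intro: finite_subset[of _ "Pow (ground M)"])
  have "{} \<in> indeps M" using M by (simp add: matroid_def)
  then obtain B where B: "B \<in> indeps M" "\<And>C. C \<in> indeps M \<Longrightarrow> B \<subseteq> C \<Longrightarrow> C = B"
    using finite_has_maximal[OF fin] by (metis empty_iff)
  have "B \<subseteq> ground M" using M B(1) by (auto simp: matroid_def)
  then have "basis M B" using B by (auto simp: basis_of_def)
  then show ?thesis by (rule that)
qed

lemma finite_ground: "matroid M \<Longrightarrow> finite (ground M)"
  by (simp add: matroid_def)

lemma basis_subset: "basis M B \<Longrightarrow> B \<subseteq> ground M"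
  by (simp add: basis_of_def)

lemma card_loops_le:
  assumes "matroid M"
  shows "card (loops M) + matroid_rank M \<le> card (ground M)"
proof -
  obtain B where B: "basis M B" using exists_basis[OF assms] .
  have "loops M \<subseteq> ground M - B" using B by (auto simp: loops_def)
  then have "card (loops M) \<le> card (ground M - B)"
    using finite_ground[OF assms] by (intro card_mono) auto
  moreover have "card (ground M - B) = card (ground M) - card B"
    using basis_subset[OF B] finite_ground[OF assms] by (meson card_Diff_subset finite_subset)
  moreover have "card B \<le> card (ground M)"
    using basis_subset[OF B] finite_ground[OF assms] by (rule card_mono[rotated])
  ultimately show ?thesis using card_basis_eq_matroid_rank[OF assms B] by linarith
qed

text \<open>In rank zero the final numerical comparison relies on the exact number of loops.\<close>

lemma loops_rank_0:
  assumes "matroid M" "matroid_rank M = 0"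
  shows "loops M = ground M"
proof -
  have "B = {}" if B: "basis M B" for B
  proof -
    have "card B = 0" using card_basis_eq_matroid_rank[OF assms(1) B] assms(2) by simp
    moreover have "finite B" using basis_subset[OF B] finite_ground[OF assms(1)] finite_subset by blast
    ultimately show ?thesis by simp
  qed
  then show ?thesis by (auto simp: loops_def)
qed

text \<open>A basis as large as the ground set would be all of it. This is how non-freeness enters
  the proof: it gives \<open>k \<ge> 1\<close>.\<close>

lemma rank_less_if_not_free:
  assumes M: "matroid M" and "\<not> free_matroid M"
  shows "matroid_rank M < card (ground M)"
proof (rule ccontr)
  assume ge: "\<not> matroid_rank M < card (ground M)"
  obtain B where B: "basis M B" using exists_basis[OF M] .
  have "B = ground M"
    using ge card_basis_eq_matroid_rank[OF M B] basis_subset[OF B] finite_ground[OF M]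
    by (intro card_seteq) auto
  then have "ground M \<in> indeps M" using B by (simp add: basis_of_def)
  then have "free_matroid M" using M unfolding free_matroid_def matroid_def by blast
  then show False using assms(2) by blast
qed

lemma lin_indep_image:
  assumes "inj_on f Y"
  shows "lin_indep m (f ` Y) v \<longleftrightarrow> lin_indep m Y (\<lambda>x. v (f x))"
proof -
  have sm: "(\<Sum>j\<in>f ` Y. c j * v j i) = (\<Sum>x\<in>Y. c (f x) * v (f x) i)" for c i
    by (simp add: sum.reindex[OF assms])
  show ?thesis
  proof
    assume L: "lin_indep m (f ` Y) v"
    show "lin_indep m Y (\<lambda>x. v (f x))"
      unfolding lin_indep_def
    proof (intro allI impI)
      fix d assume d: "lin_rel m Y (\<lambda>x. v (f x)) d"
      define c where "c = (\<lambda>j. d (the_inv_into Y f j))"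
      have cf: "c (f x) = d x" if "x \<in> Y" for x
        using that assms by (simp add: c_def the_inv_into_f_f)
      have "(\<Sum>x\<in>Y. c (f x) * v (f x) i) = (\<Sum>x\<in>Y. d x * v (f x) i)" for i
        by (rule sum.cong) (simp_all add: cf)
      then have "lin_rel m (f ` Y) v c"
        using d by (simp add: lin_rel_def sm)
      then have "\<forall>j\<in>f ` Y. c j = 0" using L by (simp add: lin_indep_def)
      then show "\<forall>x\<in>Y. d x = 0" using cf by fastforce
    qed
  next
    assume R: "lin_indep m Y (\<lambda>x. v (f x))"
    show "lin_indep m (f ` Y) v"
      unfolding lin_indep_def
    proof (intro allI impI)
      fix c assume "lin_rel m (f ` Y) v c"
      then have "lin_rel m Y (\<lambda>x. v (f x)) (\<lambda>x. c (f x))" by (simp add: lin_rel_def sm)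
      then have "\<forall>x\<in>Y. c (f x) = 0" by (rule R[unfolded lin_indep_def, THEN spec, THEN mp])
      then show "\<forall>j\<in>f ` Y. c j = 0" by simp
    qed
  qed
qed

text \<open>The ground set is numbered with a basis \<open>B\<close> first. Each remaining column is
  a combination of the columns of \<open>B\<close>, and the coefficients form
  \<open>D\<close>.\<close>

lemma exists_std_rep:
  assumes M: "matroid M" and rep: "representable TYPE('a::field) M"
  obtains \<phi> and D :: "nat \<Rightarrow> nat \<Rightarrow> 'a::field"
  where "std_rep M \<phi> (matroid_rank M) (card (ground M) - matroid_rank M) D"
proof -
  obtain A :: "'a mat" and f where f: "bij_betw f (ground M) (ground (column_matroid A))"
    and iso: "\<And>X. X \<subseteq> ground M \<Longrightarrow> X \<in> indeps M \<longleftrightarrow> f ` X \<in> indeps (column_matroid A)"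
    using rep unfolding representable_def isomorphic_def by blast
  obtain B where B: "basis M B" using exists_basis[OF M] .
  define r where "r = matroid_rank M"
  define k where "k = card (ground M) - r"
  have fE: "finite (ground M)" using M by (rule finite_ground)
  have BE: "B \<subseteq> ground M" using B by (rule basis_subset)
  have fB: "finite B" using BE fE by (rule finite_subset)
  have cB: "card B = r" unfolding r_def by (rule card_basis_eq_matroid_rank[OF M B])
  have cC: "card (ground M - B) = k" using BE fB cB by (simp add: k_def card_Diff_subset)
  obtain \<phi>1 where \<phi>1: "bij_betw \<phi>1 {..<r} B"
    using ex_bij_betw_nat_finite[OF fB] cB by (metis atLeast0LessThan)
  obtain \<phi>2 where \<phi>2: "bij_betw \<phi>2 {..<k} (ground M - B)"
    using ex_bij_betw_nat_finite[of "ground M - B"] fE cC by (metis atLeast0LessThan finite_Diff)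
  define \<phi> where "\<phi> x = (if x < r then \<phi>1 x else \<phi>2 (x - r))" for x
  have \<phi>B: "bij_betw \<phi> {..<r} B"
    using \<phi>1 by (rule bij_betw_cong[THEN iffD1, rotated]) (simp add: \<phi>_def)
  have "bij_betw \<phi> {r..<r + k} (ground M - B)"
  proof -
    have "bij_betw (\<lambda>x. x - r) {r..<r + k} {..<k}"
      by (rule bij_betw_byWitness[where f' = "\<lambda>t. r + t"]) auto
    from bij_betw_trans[OF this \<phi>2] show ?thesis
      by (rule bij_betw_cong[THEN iffD1, rotated]) (simp add: \<phi>_def)
  qed
  from bij_betw_combine[OF \<phi>B this]
  have "bij_betw \<phi> ({..<r} \<union> {r..<r + k}) (B \<union> (ground M - B))" by blast
  moreover have "{..<r} \<union> {r..<r + k} = {..<r + k}" by auto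
  moreover have "B \<union> (ground M - B) = ground M" using BE by blast
  ultimately have \<phi>: "bij_betw \<phi> {..<r + k} (ground M)" by simp
  define w where "w x = (\<lambda>i\<in>{..<dim_row A}. A $$ (i, f (\<phi> x)))" for x
  have wv: "w x \<in> fvec (dim_row A)" for x by (simp add: w_def)
  have indep: "\<phi> ` Y \<in> indeps M \<longleftrightarrow> lin_indep (dim_row A) Y w" if Y: "Y \<subseteq> {..<r + k}" for Y
  proof -
    have \<phi>Y: "\<phi> ` Y \<subseteq> ground M" using \<phi> Y by (auto simp: bij_betw_def)
    have inj\<phi>: "inj_on \<phi> Y" using \<phi> Y by (meson bij_betw_def inj_on_subset)
    have injf: "inj_on f (\<phi> ` Y)" using f \<phi>Y by (meson bij_betw_def inj_on_subset)
    have fY: "f ` \<phi> ` Y \<subseteq> {..<dim_col A}" using f \<phi>Y by (auto simp: bij_betw_def column_matroid_def)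
    have "\<phi> ` Y \<in> indeps M \<longleftrightarrow> lin_indep (dim_row A) (f ` \<phi> ` Y) (\<lambda>j i. A $$ (i, j))"
      using iso[OF \<phi>Y] fY by (simp add: indeps_column_matroid_iff lin_indep_def lin_rel_def)
    also have "\<dots> \<longleftrightarrow> lin_indep (dim_row A) Y (\<lambda>x i. A $$ (i, f (\<phi> x)))"
      by (simp add: lin_indep_image[OF injf] lin_indep_image[OF inj\<phi>])
    also have "\<dots> \<longleftrightarrow> lin_indep (dim_row A) Y w"
      by (simp add: lin_indep_def lin_rel_def w_def)
    finally show ?thesis .
  qed
  have wB: "lin_indep (dim_row A) {..<r} w"
  proof -
    have "\<phi> ` {..<r} = B" using \<phi>B by (simp add: bij_betw_def)
    then show ?thesis using indep[of "{..<r}"] B by (auto simp: basis_of_def)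
  qed
  \<comment> \<open>Otherwise adding element \<open>r + t\<close> to \<open>B\<close> would keep it
    independent, against the maximality of \<open>B\<close>.\<close>
  have "\<exists>c. w (r + t) = combination (dim_row A) {..<r} w c" if t: "t < k" for t
  proof (rule ccontr)
    assume "\<nexists>c. w (r + t) = combination (dim_row A) {..<r} w c"
    then have "w (r + t) \<notin> combination (dim_row A) {..<r} w ` ({..<r} \<rightarrow>\<^sub>E UNIV)" by auto
    then have "lin_indep (dim_row A) (insert (r + t) {..<r}) w"
      using lin_indep_insert[of "{..<r}" "r + t" "w (r + t)" "dim_row A" w] wB wv by simp
    then have ins: "\<phi> ` insert (r + t) {..<r} \<in> indeps M"
      using indep[of "insert (r + t) {..<r}"] t by auto
    have "\<phi> ` insert (r + t) {..<r} = insert (\<phi> (r + t)) B"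
      using \<phi>B by (simp add: bij_betw_def)
    moreover have "\<phi> (r + t) \<in> ground M - B" using \<phi>2 t by (auto simp: \<phi>_def bij_betw_def)
    ultimately show False using ins B by (auto simp: basis_of_def)
  qed
  then obtain d where d: "\<And>t. t < k \<Longrightarrow> w (r + t) = combination (dim_row A) {..<r} w (d t)" by metis
  define D where "D b t = d t b" for b t
  \<comment> \<open>After substituting the expansions, a relation among all columns becomes one
    among the independent columns of \<open>B\<close>, so each collected coefficient
    vanishes.\<close>
  have rel: "lin_rel (dim_row A) {..<r + k} w c \<longleftrightarrow> std_rel r k D c" for c
  proof -
    have "(\<Sum>x<r + k. c x * w x i) = (\<Sum>b<r. (c b + (\<Sum>t<k. c (r + t) * D b t)) * w b i)"
      if i: "i < dim_row A" for i
    proof -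
      have "(\<Sum>t<k. c (r + t) * w (r + t) i) = (\<Sum>t<k. \<Sum>b<r. c (r + t) * D b t * w b i)"
        by (rule sum.cong) (use i in \<open>auto simp: d combination_def D_def sum_distrib_left mult.assoc\<close>)
      also have "\<dots> = (\<Sum>b<r. (\<Sum>t<k. c (r + t) * D b t) * w b i)"
        by (subst sum.swap) (simp add: sum_distrib_right)
      finally show ?thesis by (simp add: sum_lessThan_add sum.distrib distrib_right)
    qed
    then have "lin_rel (dim_row A) {..<r + k} w c \<longleftrightarrow>
        lin_rel (dim_row A) {..<r} w (\<lambda>b. c b + (\<Sum>t<k. c (r + t) * D b t))"
      by (simp add: lin_rel_def)
    also have "\<dots> \<longleftrightarrow> std_rel r k D c"
    proof
      assume "lin_rel (dim_row A) {..<r} w (\<lambda>b. c b + (\<Sum>t<k. c (r + t) * D b t))"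
      then show "std_rel r k D c" using wB by (auto simp: lin_indep_def std_rel_def)
    qed (simp add: lin_rel_def std_rel_def)
    finally show ?thesis .
  qed
  have "std_rep M \<phi> r k D"
    unfolding std_rep_def
  proof (intro conjI allI impI \<phi>)
    fix Y assume Y: "Y \<subseteq> {..<r + k}"
    show "\<phi> ` Y \<in> indeps M \<longleftrightarrow> (\<forall>c. std_rel r k D c \<and> (\<forall>x\<in>{..<r + k} - Y. c x = 0) \<longrightarrow> (\<forall>x\<in>{..<r + k}. c x = 0))"
      unfolding indep[OF Y] lin_indep_iff_supported[OF finite_lessThan Y] rel ..
  qed
  then show ?thesis unfolding r_def k_def by (rule that)
qed

section \<open>Comparison with the claimed bound\<close>

text \<open>A finite q-Pochhammer symbol with base \<open>1 / q\<close>, starting at exponent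
  \<open>a\<close>. The range is half-open so that products concatenate.\<close>

definition qprod :: "real \<Rightarrow> nat \<Rightarrow> nat \<Rightarrow> real" where
  "qprod q a b = (\<Prod>j\<in>{a..<b}. 1 - 1 / q ^ j)"

lemma qprod_factor:
  assumes "q \<ge> (1 :: real)"
  shows "0 \<le> 1 - 1 / q ^ j" "1 - 1 / q ^ j \<le> 1"
  using assms by (auto simp: divide_simps)

lemma qprod_pos:
  assumes "q > 1" "a \<ge> 1"
  shows "qprod q a b > 0"
  unfolding qprod_def by (rule prod_pos) (use assms in \<open>auto simp: divide_simps\<close>)

lemma qprod_concat: "a \<le> b \<Longrightarrow> b \<le> c \<Longrightarrow> qprod q a c = qprod q a b * qprod q b c"
  unfolding qprod_def by (simp add: prod.atLeastLessThan_concat)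

text \<open>The factors lie between zero and one; keeping only the first suffices for the
  comparison.\<close>

lemma qprod_le_first:
  assumes "q \<ge> 1" "1 \<le> k"
  shows "qprod q 1 (Suc k) \<le> 1 - 1 / q"
proof -
  have "qprod q 2 (Suc k) \<le> 1"
    unfolding qprod_def by (rule prod_le_1) (use qprod_factor[OF assms(1)] in auto)
  moreover have "0 \<le> 1 - 1 / q" using qprod_factor[OF assms(1), of 1] by simp
  ultimately have "(1 - 1 / q) * qprod q 2 (Suc k) \<le> (1 - 1 / q) * 1"
    by (rule mult_left_mono)
  moreover have "qprod q 1 (Suc k) = (1 - 1 / q) * qprod q 2 (Suc k)"
    using qprod_concat[of 1 2 "Suc k" q] assms(2) by (simp add: qprod_def numeral_2_eq_2)
  ultimately show ?thesis by simp
qed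

text \<open>The right side is the full geometric tail after exponent \<open>a\<close>, hence a bound
  uniform in \<open>b\<close>.\<close>

lemma sum_inverse_powers_le:
  assumes "q \<ge> (2 :: real)"
  shows "(\<Sum>j\<in>{Suc a..<b}. 1 / q ^ j) \<le> 1 / (q ^ a * (q - 1))"
proof (cases "Suc a \<le> b")
  case True
  have "(\<Sum>j\<in>{Suc a..<b}. 1 / q ^ j) = 1 / (q ^ a * (q - 1)) - 1 / (q ^ (b - 1) * (q - 1))"
    using True
  proof (induction b rule: dec_induct)
    case (step b)
    then obtain b' where b: "b = Suc b'" by (cases b) auto
    have "1 / (q ^ b' * (q - 1)) = 1 / q ^ b + 1 / (q ^ b * (q - 1))"
      using assms by (simp add: b divide_simps)
    moreover have "(\<Sum>j\<in>{Suc a..<Suc b}. 1 / q ^ j) = (\<Sum>j\<in>{Suc a..<b}. 1 / q ^ j) + 1 / q ^ b"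
      using step.hyps by simp
    moreover have "b - 1 = b'" "Suc b - 1 = b" using b by simp_all
    ultimately show ?case using step.IH by simp
  qed simp
  then show ?thesis using assms by simp
qed (use assms in simp)

text \<open>The Weierstrass product inequality.\<close>

lemma prod_ge_one_minus_sum:
  fixes f :: "'i \<Rightarrow> real"
  assumes "finite A" "\<And>i. i \<in> A \<Longrightarrow> 0 \<le> f i \<and> f i \<le> 1"
  shows "1 - (\<Sum>i\<in>A. f i) \<le> (\<Prod>i\<in>A. 1 - f i)"
  using assms
proof (induction A rule: finite_induct)
  case (insert x A)
  have "(\<Prod>i\<in>A. 1 - f i) \<le> 1" using insert by (intro prod_le_1) auto
  then have "f x * (\<Prod>i\<in>A. 1 - f i) \<le> f x * 1" using insert by (intro mult_left_mono) auto
  then show ?case using insert by (simp add: algebra_simps)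
qed simp

text \<open>Splitting off the first factor before applying the union bound keeps the inequality
  strict in the limit \<open>b \<rightarrow> \<infinity>\<close>.\<close>

lemma qprod_ge:
  assumes q: "q \<ge> 2" and "a < b"
  shows "(1 - 1 / q ^ a) * (1 - 1 / (q ^ a * (q - 1))) \<le> qprod q a b"
proof -
  have "1 - 1 / (q ^ a * (q - 1)) \<le> 1 - (\<Sum>j\<in>{Suc a..<b}. 1 / q ^ j)"
    using sum_inverse_powers_le[OF q] by simp
  also have "\<dots> \<le> qprod q (Suc a) b"
    unfolding qprod_def by (rule prod_ge_one_minus_sum) (use q in \<open>auto simp: divide_simps\<close>)
  finally have "1 - 1 / (q ^ a * (q - 1)) \<le> qprod q (Suc a) b" .
  moreover have "0 \<le> 1 - 1 / q ^ a" using qprod_factor q by simp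
  ultimately show ?thesis
    using assms(2) by (simp add: qprod_def prod.atLeast_Suc_lessThan mult_left_mono)
qed

text \<open>Induction with rank \<open>Suc r\<close>. Rank one needs the sharp bound with
  \<open>- 1\<close>, which \<open>0 ^ r\<close> supplies only for \<open>r = 0\<close>. Each
  further unit of rank multiplies the binomial coefficient by at most \<open>3 / 4 * 2 ^ k\<close>,
  so the factor \<open>3 / 4\<close> gives room from rank two on.\<close>

lemma binomial_weight_le:
  fixes q :: real
  assumes q: "q \<ge> 2" and l: "l \<le> k" and k: "1 \<le> k"
  shows "real (Suc r + k choose l) * (q - 1) ^ (k + 1 - l) \<le> (3 / 4) ^ r * (q ^ (Suc r * k + 1) - 0 ^ r)"
proof (induction r)
  case 0
  let ?t = "\<lambda>j. real (Suc k choose j) * (q - 1) ^ (Suc k - j)"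
  have "(1 + (q - 1)) ^ Suc k = (\<Sum>j\<le>Suc k. ?t j)"
    by (subst binomial_ring) simp
  \<comment> \<open>Two terms of the expansion of \<open>q ^ Suc k\<close> are kept: those at
    \<open>l\<close> and at \<open>Suc k\<close>. They are distinct since \<open>l \<le> k\<close>,
    and the second equals one.\<close>
  moreover have "sum ?t {l, Suc k} \<le> (\<Sum>j\<le>Suc k. ?t j)"
    by (rule sum_mono2) (use l q in auto)
  moreover have "sum ?t {l, Suc k} = ?t l + 1" using l by simp
  ultimately show ?case by simp
next
  case (Suc r)
  let ?n = "Suc r + k"
  \<comment> \<open>Equality holds at \<open>k = 1\<close>, which is where the constant
    \<open>3 / 4\<close> comes from.\<close>
  have pow: "real k + 2 \<le> 3 / 2 * 2 ^ k"
    using k by (induction k rule: dec_induct) auto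
  have "(Suc ?n - l) * (Suc ?n choose l) = Suc ?n * (?n choose l)"
    using binomial_absorb_comp[of "Suc ?n" l] by simp
  then have eq: "real (Suc ?n - l) * real (Suc ?n choose l) = real (Suc ?n) * real (?n choose l)"
    by (metis of_nat_mult)
  have "real (r + 2) * real (Suc ?n choose l) \<le> real (Suc ?n - l) * real (Suc ?n choose l)"
    using l by (intro mult_right_mono) auto
  also have "\<dots> = real (Suc ?n) * real (?n choose l)" by (rule eq)
  also have "\<dots> \<le> real (r + 2) * (3 / 4 * 2 ^ k) * real (?n choose l)"
  proof (rule mult_right_mono)
    have "2 * (real r + real k + 2) \<le> (real r + 2) * (real k + 2)" by (simp add: algebra_simps)
    also have "\<dots> \<le> (real r + 2) * (3 / 2 * 2 ^ k)" using pow by (intro mult_left_mono) auto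
    finally show "real (Suc ?n) \<le> real (r + 2) * (3 / 4 * 2 ^ k)" by (simp add: algebra_simps)
  qed simp
  finally have "real (r + 2) * real (Suc ?n choose l) \<le> real (r + 2) * (3 / 4 * 2 ^ k * real (?n choose l))"
    by (simp add: mult_ac)
  then have "real (Suc ?n choose l) \<le> 3 / 4 * 2 ^ k * real (?n choose l)"
    by (rule mult_left_le_imp_le) simp
  also have "\<dots> \<le> 3 / 4 * q ^ k * real (?n choose l)"
    using q by (intro mult_right_mono mult_left_mono power_mono) auto
  finally have "real (Suc ?n choose l) * (q - 1) ^ (k + 1 - l) \<le>
      3 / 4 * q ^ k * real (?n choose l) * (q - 1) ^ (k + 1 - l)"
    using q by (intro mult_right_mono) auto
  also have "\<dots> = 3 / 4 * q ^ k * (real (?n choose l) * (q - 1) ^ (k + 1 - l))" by simp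
  also have "\<dots> \<le> 3 / 4 * q ^ k * ((3 / 4) ^ r * (q ^ (Suc r * k + 1) - 0 ^ r))"
    using Suc.IH q by (intro mult_left_mono) auto
  also have "\<dots> \<le> 3 / 4 * q ^ k * ((3 / 4) ^ r * q ^ (Suc r * k + 1))"
    using q by (intro mult_left_mono) auto
  also have "\<dots> = (3 / 4) ^ Suc r * (q ^ (Suc (Suc r) * k + 1) - 0 ^ Suc r)"
    by (simp add: power_add)
  finally show ?case by simp
qed

text \<open>The claimed bound and the lower bound of the double counting differ by this inequality,
  where the second factor on the right stands for the tail of \<open>qprod\<close> from
  \<open>r + k + 1\<close> on. Ranks zero, one and at least two need different estimates; rank zero
  uses \<open>l = k\<close>.\<close>

lemma minor_weight_less:
  fixes q :: real
  assumes q: "q \<ge> 2" and l: "l \<le> k" and k: "1 \<le> k" and r0: "r = 0 \<Longrightarrow> l = k"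
  shows "real (r + k choose l) * (q - 1) ^ (k - l) * qprod q 1 (Suc k) <
    q ^ (r * k) * ((1 - 1 / q ^ (r + k + 1)) * (1 - 1 / (q ^ (r + k + 1) * (q - 1))))"
proof -
  \<comment> \<open>The extra power of \<open>q - 1\<close> is \<open>q\<close> times the factor
    \<open>1 - 1 / q\<close> retained from \<open>qprod q 1 (Suc k)\<close>.\<close>
  let ?F = "real (r + k choose l) * (q - 1) ^ (k + 1 - l)"
  have pos: "0 < q" "0 < q - 1" using q by auto
  have F: "?F \<le> q ^ (r * k + 1) * (1 - 1 / (q ^ (r + k) * (q - 1)))"
  proof -
    consider "r = 0" | "r = 1" | r' where "r = Suc (Suc r')"
      by (metis One_nat_def not0_implies_Suc)
    then show ?thesis
    proof cases
      case 1
      have "q ^ 1 \<le> q ^ k" using q k by (intro power_increasing) auto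
      then have "q / q ^ k \<le> 1" using pos by (simp add: divide_simps)
      moreover have "q / (q ^ k * (q - 1)) = q / q ^ k * (1 / (q - 1))" by simp
      moreover have "q / q ^ k * (1 / (q - 1)) \<le> 1 * 1"
        by (intro mult_mono) (use q calculation in auto)
      ultimately have "q / (q ^ k * (q - 1)) \<le> 1" by linarith
      then show ?thesis using 1 r0 by (simp add: right_diff_distrib)
    next
      case 2
      have "1 / (q - 1) \<le> 1" using q by simp
      moreover have "?F \<le> q ^ (k + 1) - 1" using binomial_weight_le[OF q l k, of 0] 2 by simp
      moreover have "q ^ (k + 1) * (1 - 1 / (q ^ (1 + k) * (q - 1))) = q ^ (k + 1) - 1 / (q - 1)"
        using pos by (simp add: field_simps)
      ultimately show ?thesis using 2 by simp
    next
      case (3 r')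
      have "?F \<le> (3 / 4) ^ Suc r' * q ^ (r * k + 1)"
        using binomial_weight_le[OF q l k, of "Suc r'"] 3 by simp
      also have "\<dots> \<le> 3 / 4 * q ^ (r * k + 1)"
        using pos power_le_one[of "3 / 4 :: real" r'] by (intro mult_right_mono) auto
      also have "\<dots> \<le> (1 - 1 / (q ^ (r + k) * (q - 1))) * q ^ (r * k + 1)"
      proof (rule mult_right_mono)
        have "(4 :: real) \<le> 2 ^ 2 * 1" by simp
        also have "\<dots> \<le> q ^ (r + k) * (q - 1)"
        proof (rule mult_mono)
          have "(2 :: real) ^ 2 \<le> q ^ 2" using q by (intro power_mono) auto
          also have "\<dots> \<le> q ^ (r + k)" using q 3 by (intro power_increasing) auto
          finally show "(2 :: real) ^ 2 \<le> q ^ (r + k)" .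
        qed (use q in auto)
        finally have "1 / (q ^ (r + k) * (q - 1)) \<le> 1 / 4" by (intro divide_left_mono) auto
        then show "3 / 4 \<le> 1 - 1 / (q ^ (r + k) * (q - 1))" by simp
      qed (use pos in simp)
      finally show ?thesis by (simp add: mult.commute)
    qed
  qed
  have "real (r + k choose l) * (q - 1) ^ (k - l) * qprod q 1 (Suc k) \<le>
      real (r + k choose l) * (q - 1) ^ (k - l) * (1 - 1 / q)"
    using q qprod_le_first[of q k] k by (intro mult_left_mono) auto
  also have "\<dots> = ?F / q"
    using l pos by (simp add: Suc_diff_le field_simps)
  also have "\<dots> \<le> q ^ (r * k + 1) * (1 - 1 / (q ^ (r + k) * (q - 1))) / q"
    using F pos by (intro divide_right_mono) auto
  also have "\<dots> = q ^ (r * k) * (1 - 1 / (q ^ (r + k) * (q - 1)))" using pos by simp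
  \<comment> \<open>The geometric tail after exponent \<open>r + k\<close> splits into its first
    term and the rest. Expanding the product therefore leaves a positive cross term, which makes the
    inequality strict.\<close>
  also have "\<dots> < q ^ (r * k) * ((1 - 1 / q ^ (r + k + 1)) * (1 - 1 / (q ^ (r + k + 1) * (q - 1))))"
  proof (rule mult_strict_left_mono)
    define Q where "Q = q ^ (r + k)"
    have Q: "Q > 0" using pos by (simp add: Q_def)
    have "1 / (Q * (q - 1)) = 1 / (Q * q) + 1 / (Q * q * (q - 1))"
      using pos Q by (simp add: divide_simps)
    then have "(1 - 1 / (Q * q)) * (1 - 1 / (Q * q * (q - 1))) =
        1 - 1 / (Q * (q - 1)) + 1 / (Q * q) * (1 / (Q * q * (q - 1)))"
      by (simp only: left_diff_distrib right_diff_distrib mult_1 mult_1_right)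
    moreover have "1 / (Q * q) * (1 / (Q * q * (q - 1))) > 0" using pos Q by simp
    ultimately show "1 - 1 / (q ^ (r + k) * (q - 1)) <
      (1 - 1 / q ^ (r + k + 1)) * (1 - 1 / (q ^ (r + k + 1) * (q - 1)))"
      by (simp add: Q_def mult_ac)
  qed (use pos in simp)
  finally show ?thesis .
qed

section \<open>The counts and the claimed bound in terms of \<open>qprod\<close>\<close>

lemma prod_diff_powers:
  fixes q :: nat
  assumes q: "q \<ge> 1" and N: "N \<le> m"
  shows "real (\<Prod>i<N. q ^ m - q ^ i) = real q ^ (m * N) * qprod (real q) (Suc m - N) (Suc m)"
proof -
  have "real (\<Prod>i<N. q ^ m - q ^ i) = (\<Prod>i<N. real q ^ m * (1 - 1 / real q ^ (m - i)))"
    unfolding of_nat_prod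
  proof (rule prod.cong)
    fix i assume "i \<in> {..<N}"
    then have i: "i \<le> m" using N by simp
    then have "q ^ i \<le> q ^ m" using q by (intro power_increasing) auto
    then have "real (q ^ m - q ^ i) = real q ^ m - real q ^ i" by (simp add: of_nat_diff)
    also have "real q ^ i = real q ^ m * (1 / real q ^ (m - i))"
      using q i by (simp add: power_diff)
    finally show "real (q ^ m - q ^ i) = real q ^ m * (1 - 1 / real q ^ (m - i))"
      by (simp add: right_diff_distrib)
  qed simp
  also have "\<dots> = real q ^ (m * N) * (\<Prod>i<N. 1 - 1 / real q ^ (m - i))"
    by (simp add: prod.distrib power_mult)
  also have "(\<Prod>i<N. 1 - 1 / real q ^ (m - i)) = qprod (real q) (Suc m - N) (Suc m)"
    unfolding qprod_def
    by (rule prod.reindex_bij_witness[of _ "\<lambda>j. m - j" "\<lambda>i. m - i"]) (use N in auto)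
  finally show ?thesis .
qed

text \<open>The product in the bound runs over the exponents from \<open>k\<close> to
  \<open>r + k - 1\<close>, and the prefactor supplies the exponent \<open>r + k\<close>.\<close>

lemma minor_prob_bound_eq:
  assumes q: "q \<ge> 1" and e: "card (ground M) = r + k" and r: "matroid_rank M = r" and k: "k \<ge> 1"
  shows "(1 - real q powi (- int (card (ground M)))) * minor_prob_bound (card (ground M) - 1) q M =
    real (r + k choose card (loops M)) * (real q - 1) ^ (k - card (loops M)) /
      real q ^ ((r + k - 1) * k) * qprod (real q) k (r + k + 1)"
proof -
  have "(\<Prod>i<r. 1 - real q powi (int i - int (r + k - 1))) = (\<Prod>i<r. 1 - 1 / real q ^ (r + k - 1 - i))"
  proof (rule prod.cong)
    fix i assume "i \<in> {..<r}"
    then have "int i - int (r + k - 1) = - int (r + k - 1 - i)" using k by (simp add: of_nat_diff)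
    then show "1 - real q powi (int i - int (r + k - 1)) = 1 - 1 / real q ^ (r + k - 1 - i)"
      by (simp add: power_int_minus_divide)
  qed simp
  also have "\<dots> = qprod (real q) k (r + k)"
    unfolding qprod_def
    by (rule prod.reindex_bij_witness[of _ "\<lambda>j. r + k - 1 - j" "\<lambda>i. r + k - 1 - i"]) (use k in auto)
  finally have "(\<Prod>i<r. 1 - real q powi (int i - int (r + k - 1))) * (1 - 1 / real q ^ (r + k)) =
      qprod (real q) k (r + k + 1)"
    by (simp add: qprod_def)
  moreover have "1 - real q powi (- int (r + k)) = 1 - 1 / real q ^ (r + k)"
    by (simp add: power_int_minus_divide del: of_nat_add)
  ultimately show ?thesis
    unfolding minor_prob_bound_def Let_def e r by (simp add: mult_ac)
qed

section \<open>Asymptotics of the minor probability\<close>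

text \<open>The counting bound is divided by the number of all matrices with
  \<open>n = m + 1\<close> columns, the fewest that the hypothesis \<open>n > m\<close>
  allows.\<close>

lemma prob_minor_square_ge:
  fixes D :: "nat \<Rightarrow> nat \<Rightarrow> 'a::{finite,field}"
  assumes rep: "std_rep M \<phi> r k D" and k: "1 \<le> k" and m: "k \<le> m"
  defines "q \<equiv> real CARD('a)"
  shows "(1 - real (r + k) * (1 - 1 / q ^ k) ^ (Suc m div (r + k))) *
      (qprod q k (Suc m) / (q ^ (k * (k - 1)) * qprod q 1 (Suc k))) \<le>
    measure_pmf.prob (uniform_mat m (Suc m) :: 'a mat pmf) {A. minor_of M (column_matroid A)}"
proof -
  let ?c = "real (card {a \<in> {..<Suc m} \<rightarrow>\<^sub>E fvec m.
    minor_of M (column_matroid (mat_of m (Suc m) (a :: nat \<Rightarrow> nat \<Rightarrow> 'a)))})"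
  let ?\<epsilon> = "1 - real (r + k) * (1 - 1 / q ^ k) ^ (Suc m div (r + k))"
  have q: "q \<ge> 2" using card_field_ge_2[where 'a = 'a] by (simp add: q_def)
  have pos: "qprod q 1 (Suc k) > 0" using q by (intro qprod_pos) auto
  have "real (\<Prod>i<Suc m - k. CARD('a) ^ m - CARD('a) ^ i) = q ^ (m * (Suc m - k)) * qprod q k (Suc m)"
    using prod_diff_powers[of "CARD('a)" "Suc m - k" m] card_field_ge_2[where 'a = 'a] k m
    by (simp add: q_def)
  moreover have "real (\<Prod>i<k. CARD('a) ^ k - CARD('a) ^ i) = q ^ (k * k) * qprod q 1 (Suc k)"
    using prod_diff_powers[of "CARD('a)" k k] card_field_ge_2[where 'a = 'a] by (simp add: q_def)
  ultimately have *: "q ^ (k * Suc m) * ?\<epsilon> * (q ^ (m * (Suc m - k)) * qprod q k (Suc m)) \<le>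
      ?c * (q ^ (k * k) * qprod q 1 (Suc k))"
    using card_minor_dual_ge[OF rep, of "Suc m" m] by (simp add: q_def)
  \<comment> \<open>Balance of the powers of \<open>q\<close>: with \<open>n = m + 1\<close>, the
    exponent \<open>k * n + m * (n - k) - k * k - m * n\<close> equals
    \<open>- k * (k - 1)\<close>.\<close>
  have ex: "k * Suc m + m * (Suc m - k) + k * (k - 1) = m * Suc m + k * k"
  proof -
    obtain d where "m = k + d" using m le_Suc_ex by blast
    moreover obtain k' where "k = Suc k'" using k by (cases k) auto
    ultimately show ?thesis by (simp add: algebra_simps)
  qed
  have "?\<epsilon> * qprod q k (Suc m) * q ^ (m * Suc m) * q ^ (k * k) =
      q ^ (k * Suc m) * ?\<epsilon> * (q ^ (m * (Suc m - k)) * qprod q k (Suc m)) * q ^ (k * (k - 1))"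
  proof -
    have "q ^ (m * Suc m) * q ^ (k * k) = q ^ (k * Suc m) * q ^ (m * (Suc m - k)) * q ^ (k * (k - 1))"
      unfolding power_add[symmetric] ex ..
    then have "?\<epsilon> * qprod q k (Suc m) * (q ^ (m * Suc m) * q ^ (k * k)) =
        ?\<epsilon> * qprod q k (Suc m) * (q ^ (k * Suc m) * q ^ (m * (Suc m - k)) * q ^ (k * (k - 1)))"
      by (rule arg_cong)
    then show ?thesis by (simp only: mult_ac)
  qed
  also have "\<dots> \<le> ?c * (q ^ (k * k) * qprod q 1 (Suc k)) * q ^ (k * (k - 1))"
    using * q by (intro mult_right_mono) auto
  finally have "(?\<epsilon> * qprod q k (Suc m) * q ^ (m * Suc m)) * q ^ (k * k) \<le>
      (?c * (q ^ (k * (k - 1)) * qprod q 1 (Suc k))) * q ^ (k * k)"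
    by (simp only: mult_ac)
  then have "?\<epsilon> * qprod q k (Suc m) * q ^ (m * Suc m) \<le> ?c * (q ^ (k * (k - 1)) * qprod q 1 (Suc k))"
    by (rule mult_right_le_imp_le) (use q in simp)
  then have "?\<epsilon> * qprod q k (Suc m) / (q ^ (k * (k - 1)) * qprod q 1 (Suc k)) \<le> ?c / q ^ (m * Suc m)"
    using q pos by (simp add: divide_simps mult_ac del: mult_Suc_right power_Suc)
  then show ?thesis unfolding prob_uniform_mat q_def by simp
qed

lemma prob_minor_std_ge:
  fixes D :: "nat \<Rightarrow> nat \<Rightarrow> 'a::{finite,field}"
  assumes "std_rep M \<phi> r k D" "r \<le> m"
  shows "1 - real (r + k) * (1 - 1 / real CARD('a) ^ m) ^ (n div (r + k)) \<le>
    measure_pmf.prob (uniform_mat m n :: 'a mat pmf) {A. minor_of M (column_matroid A)}"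
proof -
  have "real CARD('a) ^ (m * n) > 0" by simp
  then show ?thesis
    unfolding prob_uniform_mat using card_minor_std_ge[OF assms, of n]
    by (simp add: pos_le_divide_eq mult.commute)
qed

text \<open>A strict bound on the limit inferior requires a fixed constant \<open>c\<close> strictly
  above the claimed value. Since \<open>m n\<close> need not converge, each \<open>n\<close> is
  treated according to whether \<open>m n\<close> reaches a threshold \<open>L\<close>: above it the
  dual pattern is used, below it the pattern \<open>[I | D]\<close>.\<close>

lemma prob_minor_eventually_ge:
  fixes D :: "nat \<Rightarrow> nat \<Rightarrow> 'a::{finite,field}"
  assumes rep: "std_rep M \<phi> r k D" and k: "1 \<le> k"
    and l: "l \<le> k" "r = 0 \<Longrightarrow> l = k"
    and m: "\<forall>\<^sub>F n in sequentially. n > m n \<and> m n \<ge> r + k"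
  defines "q \<equiv> real CARD('a)"
  shows "\<exists>c > real (r + k choose l) * (q - 1) ^ (k - l) / q ^ ((r + k - 1) * k) * qprod q k (r + k + 1).
    \<forall>\<^sub>F n in sequentially.
      c \<le> measure_pmf.prob (uniform_mat (m n) n :: 'a mat pmf) {A. minor_of M (column_matroid A)}"
proof -
  let ?P = "\<lambda>m n. measure_pmf.prob (uniform_mat m n :: 'a mat pmf) {A. minor_of M (column_matroid A)}"
  define e where "e = r + k"
  define T where "T = real (e choose l) * (q - 1) ^ (k - l) / q ^ ((e - 1) * k) * qprod q k (e + 1)"
  define \<gamma> where "\<gamma> = (1 - 1 / q ^ (e + 1)) * (1 - 1 / (q ^ (e + 1) * (q - 1)))"
  \<comment> \<open>\<open>C\<close> is the bound for \<open>m + 1\<close> columns without its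
    pattern factor, with the tail of \<open>qprod\<close> replaced by the lower bound
    \<open>\<gamma>\<close>, so that it no longer depends on \<open>m\<close>.\<close>
  define C where "C = qprod q k (e + 1) * \<gamma> / (q ^ (k * (k - 1)) * qprod q 1 (Suc k))"
  define \<delta> where "\<delta> v n = 1 - real e * (1 - 1 / real v) ^ (n div e)" for v n :: nat
  have q: "q \<ge> 2" using card_field_ge_2[where 'a = 'a] by (simp add: q_def)
  have e: "e > 0" "k \<le> e" using k by (simp_all add: e_def)
  have pos: "qprod q 1 (Suc k) > 0" "qprod q k (e + 1) > 0" using q k by (auto intro!: qprod_pos)
  have TC: "T < C"
  proof -
    have ex: "(e - 1) * k = r * k + k * (k - 1)"
      using k by (cases k) (simp_all add: e_def algebra_simps)
    have "real (e choose l) * (q - 1) ^ (k - l) * qprod q 1 (Suc k) < q ^ (r * k) * \<gamma>"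
      unfolding e_def \<gamma>_def by (rule minor_weight_less[OF q l(1) k l(2)])
    then have "real (e choose l) * (q - 1) ^ (k - l) < q ^ (r * k) * \<gamma> / qprod q 1 (Suc k)"
      using pos by (simp add: pos_less_divide_eq)
    then have "real (e choose l) * (q - 1) ^ (k - l) * (qprod q k (e + 1) / q ^ ((e - 1) * k)) <
        q ^ (r * k) * \<gamma> / qprod q 1 (Suc k) * (qprod q k (e + 1) / q ^ ((e - 1) * k))"
      using pos q by (intro mult_strict_right_mono) auto
    also have "\<dots> = C"
      using q unfolding C_def ex power_add by (simp add: mult.commute)
    finally show ?thesis by (simp add: T_def)
  qed
  have \<gamma>: "\<gamma> \<ge> 0"
  proof -
    have 1: "1 \<le> q ^ (e + 1)" using q by (intro one_le_power) auto
    then have "1 * 1 \<le> q ^ (e + 1) * (q - 1)" using q by (intro mult_mono) auto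
    then show ?thesis unfolding \<gamma>_def
      using 1 by (intro mult_nonneg_nonneg) (simp_all only: diff_ge_0_iff_ge divide_le_eq_1 mult_1, auto)
  qed
  have C0: "C \<ge> 0" unfolding C_def using \<gamma> pos q by (intro divide_nonneg_nonneg mult_nonneg_nonneg) auto
  have large: "\<delta> (CARD('a) ^ k) (Suc m) * C \<le> ?P m (Suc m)"
    if "e < m" "0 \<le> \<delta> (CARD('a) ^ k) (Suc m)" for m
  proof -
    have "qprod q k (e + 1) * \<gamma> \<le> qprod q k (e + 1) * qprod q (e + 1) (Suc m)"
      unfolding \<gamma>_def using pos that by (intro mult_left_mono qprod_ge q) auto
    also have "\<dots> = qprod q k (Suc m)"
      using that e by (intro qprod_concat[symmetric]) auto
    finally have "C \<le> qprod q k (Suc m) / (q ^ (k * (k - 1)) * qprod q 1 (Suc k))"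
      unfolding C_def using pos q by (intro divide_right_mono) auto
    then have "\<delta> (CARD('a) ^ k) (Suc m) * C \<le>
        \<delta> (CARD('a) ^ k) (Suc m) * (qprod q k (Suc m) / (q ^ (k * (k - 1)) * qprod q 1 (Suc k)))"
      using that by (intro mult_left_mono)
    also have "\<dots> \<le> ?P m (Suc m)"
      using prob_minor_square_ge[OF rep k, of m] that e unfolding \<delta>_def q_def e_def by simp
    finally show ?thesis .
  qed
  have \<delta>1: "\<delta> v \<longlonglongrightarrow> 1" if "v > 0" for v
    unfolding \<delta>_def using pattern_bound_tendsto[OF e(1) that] .
  \<comment> \<open>The midpoint exceeds \<open>T\<close> strictly and leaves room for the pattern
    factor, which only tends to one.\<close>
  define c where "c = (T + C) / 2"
  have c: "T < c" "c < C" using TC by (auto simp: c_def)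
  have "(\<lambda>m. \<delta> (CARD('a) ^ k) (Suc m)) \<longlonglongrightarrow> 1"
    by (rule LIMSEQ_Suc[OF \<delta>1]) simp
  note lim = this tendsto_mult[OF this tendsto_const[of C]]
  have "\<forall>\<^sub>F m in sequentially. c < \<delta> (CARD('a) ^ k) (Suc m) * C \<and> 0 < \<delta> (CARD('a) ^ k) (Suc m) \<and> e < m"
    using c(2) by (intro eventually_conj order_tendstoD(1)[OF lim(1)] order_tendstoD(1)[OF lim(2)]
        eventually_gt_at_top) auto
  then obtain L where L: "\<And>m. m \<ge> L \<Longrightarrow>
      c < \<delta> (CARD('a) ^ k) (Suc m) * C \<and> 0 < \<delta> (CARD('a) ^ k) (Suc m) \<and> e < m"
    unfolding eventually_sequentially by blast
  have big: "c \<le> ?P m n" if "m \<ge> L" "n > m" for m n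
    using L[OF that(1)] large[of m] prob_minor_mono[of "Suc m" n m M, where 'a = 'a] that(2) by fastforce
  \<comment> \<open>At \<open>m = L\<close> a probability exceeds \<open>c\<close>. This is needed
    because the bound for small \<open>m\<close> only tends to one.\<close>
  have "c < 1"
    using L[of L] large[of L] measure_pmf.prob_le_1[of "uniform_mat L (Suc L) :: 'a mat pmf"]
    by (meson le_less_trans less_imp_le less_le_trans order_refl)
  then have "\<forall>m\<in>{..<L}. \<forall>\<^sub>F n in sequentially. c < \<delta> (CARD('a) ^ m) n"
    using \<delta>1 by (intro ballI order_tendstoD(1)[OF \<delta>1]) auto
  \<comment> \<open>Only finitely many heights lie below \<open>L\<close>, so one threshold for
    \<open>n\<close> serves them all, however \<open>m n\<close> varies.\<close>
  then have "\<forall>\<^sub>F n in sequentially. \<forall>m\<in>{..<L}. c < \<delta> (CARD('a) ^ m) n"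
    by (intro eventually_ball_finite) auto
  with m have "\<forall>\<^sub>F n in sequentially. c \<le> ?P (m n) n"
  proof eventually_elim
    case (elim n)
    show ?case
    proof (cases "m n \<ge> L")
      case True
      then show ?thesis using big elim by blast
    next
      case False
      then have "c < \<delta> (CARD('a) ^ m n) n" using elim by simp
      also have "\<dots> \<le> ?P (m n) n"
        using prob_minor_std_ge[OF rep, of "m n" n] elim by (simp add: \<delta>_def e_def)
      finally show ?thesis by simp
    qed
  qed
  then show ?thesis using c(1) unfolding T_def e_def by blast
qed

theorem theorem7:
  fixes M :: "'e set_system" and m :: "nat \<Rightarrow> nat" and q :: nat
  assumes q: "q = CARD('a::{finite,field})"
    and "matroid M"
    and "\<not> free_matroid M"
    and "representable TYPE('a) M"
    and "\<forall>\<^sub>F n in sequentially. n > m n \<and> m n \<ge> card (ground M)"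
  shows "liminf (\<lambda>n. ereal (measure_pmf.prob (uniform_mat (m n) n :: 'a mat pmf)
                               {A. minor_of M (column_matroid A)}))
         > ereal ((1 - real q powi (- int (card (ground M)))) *
                  minor_prob_bound (card (ground M) - 1) q M)"
proof -
  define r where "r = matroid_rank M"
  define k where "k = card (ground M) - r"
  have k: "1 \<le> k" and e: "card (ground M) = r + k"
    using rank_less_if_not_free[OF assms(2,3)] by (simp_all add: r_def k_def)
  obtain \<phi> and D :: "nat \<Rightarrow> nat \<Rightarrow> 'a" where rep: "std_rep M \<phi> r k D"
    using exists_std_rep[OF assms(2,4)] unfolding r_def k_def .
  have l: "card (loops M) \<le> k"
    using card_loops_le[OF assms(2)] by (simp add: k_def r_def)
  have l0: "card (loops M) = k" if "r = 0"
    using loops_rank_0[OF assms(2)] that by (simp add: k_def r_def)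
  \<comment> \<open>The constant \<open>c\<close> keeps the inequality strict in the limit
    inferior.\<close>
  obtain c where c: "c > (1 - real q powi (- int (card (ground M)))) * minor_prob_bound (card (ground M) - 1) q M"
    and ev: "\<forall>\<^sub>F n in sequentially.
      c \<le> measure_pmf.prob (uniform_mat (m n) n :: 'a mat pmf) {A. minor_of M (column_matroid A)}"
    using prob_minor_eventually_ge[OF rep k l l0, of m] assms(5)
      minor_prob_bound_eq[of q M r k] card_field_ge_2[where 'a = 'a] k
    unfolding q e r_def by auto
  have "ereal c \<le> liminf (\<lambda>n. ereal (measure_pmf.prob (uniform_mat (m n) n :: 'a mat pmf)
                               {A. minor_of M (column_matroid A)}))"
    by (rule Liminf_bounded) (use ev in simp)
  then show ?thesis using c by (meson less_ereal.simps(1) less_le_trans)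
qed

end
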